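(* Let $G$ be a finite abstract graph with $n$ vertices and $m$ edges. If $G$ admits a spherical thrackle drawing, then $n\geq m$.
   Context: A thrackle drawing of a graph $G$ on a surface is a drawing in which every pair of distinct edges intersects in exactly one point, which is either a common endpoint or a proper crossing. A spherical thrackle drawing is a thrackle drawing on the unit sphere $S^2\subset\mathbb{R}^3$ in which the vertices are points and every edge is drawn as an arc of a great circle (such an arc may have length greater than $\pi$). *)

theory Defs
  imports "HOL-Analysis.Analysis"
begin

definition finite_graph :: "'v set \<Rightarrow> 'v set set \<Rightarrow> bool" where
  "finite_graph V E \<longleftrightarrow> finite V \<and> (\<forall>e\<in>E. \<exists>u\<in>V. \<exists>v\<in>V. u \<noteq> v \<and> e = {u, v})"

definition drawing ::
  "'a::topological_space set \<Rightarrow> 'v set \<Rightarrow> 'v set set \<Rightarrow> ('v \<Rightarrow> 'a) \<Rightarrow> ('v set \<Rightarrow> real \<Rightarrow> 'a) \<Rightarrow> bool" where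
  "drawing S V E p \<gamma> \<longleftrightarrow>
     inj_on p V \<and> p ` V \<subseteq> S \<and>
     (\<forall>e\<in>E. arc (\<gamma> e) \<and> path_image (\<gamma> e) \<subseteq> S \<and>
            {pathstart (\<gamma> e), pathfinish (\<gamma> e)} = p ` e \<and>
            path_image (\<gamma> e) \<inter> p ` V = p ` e)"

text \<open>In a proper crossing the common point is interior to both curves, and near it the two
  curves look, up to a homeomorphism of the surface, like the coordinate axes in the unit disc.\<close>

definition proper_crossing ::
  "'a::topological_space set \<Rightarrow> (real \<Rightarrow> 'a) \<Rightarrow> (real \<Rightarrow> 'a) \<Rightarrow> 'a \<Rightarrow> bool" where
  "proper_crossing S g h x \<longleftrightarrow>
     x \<in> path_image g - {pathstart g, pathfinish g} \<and>
     x \<in> path_image h - {pathstart h, pathfinish h} \<and>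
     (\<exists>U \<phi> \<psi>. openin (top_of_set S) U \<and> x \<in> U \<and>
        homeomorphism U (ball (0::complex) 1) \<phi> \<psi> \<and> \<phi> x = 0 \<and>
        \<phi> ` (path_image g \<inter> U) = {z \<in> ball 0 1. Im z = 0} \<and>
        \<phi> ` (path_image h \<inter> U) = {z \<in> ball 0 1. Re z = 0})"

definition thrackle_drawing ::
  "'a::topological_space set \<Rightarrow> 'v set \<Rightarrow> 'v set set \<Rightarrow> ('v \<Rightarrow> 'a) \<Rightarrow> ('v set \<Rightarrow> real \<Rightarrow> 'a) \<Rightarrow> bool" where
  "thrackle_drawing S V E p \<gamma> \<longleftrightarrow>
     drawing S V E p \<gamma> \<and>
     (\<forall>e\<in>E. \<forall>f\<in>E. e \<noteq> f \<longrightarrow>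
        (\<exists>x. path_image (\<gamma> e) \<inter> path_image (\<gamma> f) = {x} \<and>
             (x \<in> p ` (e \<inter> f) \<or> proper_crossing S (\<gamma> e) (\<gamma> f) x)))"

text \<open>The orthonormal pair \<open>a\<close>, \<open>b\<close> spans the plane of the great circle, and \<open>L\<close> is the length
  of the arc, which may exceed \<open>pi\<close>. The curve \<open>g\<close> may be any parametrization of the arc.\<close>

definition great_circle_arc :: "(real \<Rightarrow> real^3) \<Rightarrow> bool" where
  "great_circle_arc g \<longleftrightarrow>
     arc g \<and>
     (\<exists>a b L. norm a = 1 \<and> norm b = 1 \<and> a \<bullet> b = 0 \<and> 0 < L \<and> L < 2 * pi \<and>
        path_image g = (\<lambda>t. cos t *\<^sub>R a + sin t *\<^sub>R b) ` {0..L} \<and>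
        pathstart g = a \<and> pathfinish g = cos L *\<^sub>R a + sin L *\<^sub>R b)"

definition spherical_thrackle_drawing ::
  "'v set \<Rightarrow> 'v set set \<Rightarrow> ('v \<Rightarrow> real^3) \<Rightarrow> ('v set \<Rightarrow> real \<Rightarrow> real^3) \<Rightarrow> bool" where
  "spherical_thrackle_drawing V E p \<gamma> \<longleftrightarrow>
     thrackle_drawing (sphere 0 1) V E p \<gamma> \<and> (\<forall>e\<in>E. great_circle_arc (\<gamma> e))"

end

theory Submission imports Defs begin

text \<open>
  After a small perturbation the vertices are vectors in general position, every edge is short
  (less than \<open>pi\<close>) or long, and the thrackle condition becomes sign conditions on the coefficients
  of the linear relations between the ends of disjoint edges. Deleting vertices of degree at most
  one, we may assume that all degrees are at least two. As for straight-line thrackles in the plane,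
  let every vertex mark its leftmost edge. Every edge is marked, except possibly the edge \<open>wt\<close> of a
  triangle \<open>uwt\<close> with \<open>uw\<close> long and \<open>ut\<close>, \<open>wt\<close> short, and there is at most one such triangle.

  If there were more edges than vertices, every vertex would mark an edge and no edge would be
  marked twice. Short edges cross the great circle of every edge disjoint from them, so they
  alternate between its two sides; in particular the short component \<open>D\<close> of \<open>t\<close> is bipartite. A parity
  argument along the cycle of leftmost edges then yields a long edge other than \<open>uw\<close> with an end in
  \<open>D\<close>, oriented like \<open>uw\<close>; the mirror image yields one with the opposite orientation. Two such edges
  cannot coexist.
\<close>

section \<open>Sign configurations\<close>

text \<open>For straight-line thrackles the marking alone gives the bound: an edge that escapes it
  would have further edges at its two ends on different sides, and these could not cross. On the
  sphere a long arc leaves its end away from the other end, and this is how \<open>wt\<close> can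
  escape. The count then fails by at most one, so an excess makes the marking tight, which is what
  allows one to follow leftmost edges along a cycle. Every hypothesis survives a change of sign of
  all determinants, so rightmost edges come for free. Nearly all contradictions have one shape: two
  linear functionals put two points of an arc, or of a great circle, into opposite orders. An edge
  keeps its class under the perturbation, and length exactly \<open>pi\<close> counts as short. The
  ends of such an edge are antipodal and span no plane, so an arbitrary perturbation could make it
  short or long; hence the perturbation has a prescribed first order term and is generic only in
  second order. Of two adjacent edges at most one is long; this matching property supplies a short
  neighbour at both ends of every long edge.\<close>

lemma sign_of_balance:
  fixes a b x y :: real
  assumes "a * x = b * y" "a > 0" "b > 0"
  shows "x > 0 \<longleftrightarrow> y > 0" "x < 0 \<longleftrightarrow> y < 0"
  using assms by (metis mult_less_0_iff not_less_iff_gr_or_eq zero_less_mult_iff)+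

lemma sign_of_cancellation:
  fixes a b x y :: real
  assumes "a * x + b * y = 0" "a > 0" "b > 0"
  shows "x > 0 \<longleftrightarrow> y < 0" "x < 0 \<longleftrightarrow> y > 0"
proof -
  have "a * x = b * (- y)" using assms(1) by simp
  from sign_of_balance[OF this assms(2,3)] show "x > 0 \<longleftrightarrow> y < 0" "x < 0 \<longleftrightarrow> y > 0" by auto
qed

lemma sign_of_coefficients:
  fixes a b x y :: real
  assumes "a * x + b * y = 0" "x > 0" "y > 0"
  shows "a > 0 \<longleftrightarrow> b < 0" "a < 0 \<longleftrightarrow> b > 0"
  using sign_of_cancellation[of x a y b] assms by (simp_all add: mult.commute)

text \<open>\<open>\<Delta> a b c\<close> stands for the determinant of the position vectors, and \<open>S\<close>, \<open>L\<close> for the short and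
  long edges. Disjoint edges \<open>ab\<close> and \<open>cd\<close> meet on the line spanned by
  \<open>\<alpha> a + \<beta> b = \<gamma> c + \<delta> d\<close>; a short arc consists of the combinations with nonnegative coefficients,
  a long arc of the other ones (and its ends), and exactly one of the two antipodal points of this line
  lies on both arcs. The relation between the vectors is only used after applying a functional
  \<open>\<Delta> x y\<close> to it. Two adjacent long arcs would also meet at the antipode of their common end.\<close>

locale thrackle_configuration =
  fixes V :: "'v set" and \<Delta> :: "'v \<Rightarrow> 'v \<Rightarrow> 'v \<Rightarrow> real" and S L :: "'v \<Rightarrow> 'v \<Rightarrow> bool"
  assumes finite_V: "finite V"
    and rotate: "\<Delta> a b c = \<Delta> b c a"
    and swap: "\<Delta> b a c = - \<Delta> a b c"
    and general_position: "\<lbrakk>a \<in> V; b \<in> V; c \<in> V; a \<noteq> b; b \<noteq> c; a \<noteq> c\<rbrakk> \<Longrightarrow> \<Delta> a b c \<noteq> 0"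
    and S_sym: "S a b \<Longrightarrow> S b a" and L_sym: "L a b \<Longrightarrow> L b a"
    and S_in: "S a b \<Longrightarrow> a \<in> V" and L_in: "L a b \<Longrightarrow> a \<in> V"
    and S_irrefl: "\<not> S a a" and L_irrefl: "\<not> L a a"
    and not_S_L: "\<lbrakk>S a b; L a b\<rbrakk> \<Longrightarrow> False"
    and L_unique: "\<lbrakk>L a b; L a c\<rbrakk> \<Longrightarrow> b = c"
    and cross_SS: "\<lbrakk>S a b; S c d; {a, b} \<inter> {c, d} = {}\<rbrakk> \<Longrightarrow>
      \<exists>\<alpha> \<beta> \<gamma> \<delta>. \<alpha> > 0 \<and> \<beta> > 0 \<and> \<gamma> > 0 \<and> \<delta> > 0 \<and>
        (\<forall>x y. \<alpha> * \<Delta> x y a + \<beta> * \<Delta> x y b = \<gamma> * \<Delta> x y c + \<delta> * \<Delta> x y d)"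
    and cross_LS: "\<lbrakk>L a b; S c d; {a, b} \<inter> {c, d} = {}\<rbrakk> \<Longrightarrow>
      \<exists>\<alpha> \<beta> \<gamma> \<delta>. (\<alpha> < 0 \<or> \<beta> < 0) \<and> \<gamma> > 0 \<and> \<delta> > 0 \<and>
        (\<forall>x y. \<alpha> * \<Delta> x y a + \<beta> * \<Delta> x y b = \<gamma> * \<Delta> x y c + \<delta> * \<Delta> x y d)"
    and cross_LL: "\<lbrakk>L a b; L c d; {a, b} \<inter> {c, d} = {}\<rbrakk> \<Longrightarrow>
      \<exists>\<alpha> \<beta> \<gamma> \<delta>. (\<alpha> > 0 \<and> \<beta> > 0 \<and> (\<gamma> > 0 \<or> \<delta> > 0) \<or> \<gamma> > 0 \<and> \<delta> > 0 \<and> (\<alpha> > 0 \<or> \<beta> > 0)) \<and>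
        (\<forall>x y. \<alpha> * \<Delta> x y a + \<beta> * \<Delta> x y b = \<gamma> * \<Delta> x y c + \<delta> * \<Delta> x y d)"
begin

lemma Delta_degenerate [simp]: "\<Delta> a a b = 0" "\<Delta> a b a = 0" "\<Delta> b a a = 0"
proof -
  show 1: "\<Delta> a a b = 0" for a b using swap[of a a b] by simp
  show "\<Delta> a b a = 0" using rotate[of a a b] 1 by metis
  show "\<Delta> b a a = 0" using rotate[of b a a] 1 by metis
qed

lemma swap_right: "\<Delta> a c b = - \<Delta> a b c"
  using rotate swap by metis

lemma S_in2: "S a b \<Longrightarrow> b \<in> V" using S_in S_sym by blast
lemma L_in2: "L a b \<Longrightarrow> b \<in> V" using L_in L_sym by blast
lemma S_neq: "S a b \<Longrightarrow> a \<noteq> b" using S_irrefl by blast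
lemma L_neq: "L a b \<Longrightarrow> a \<noteq> b" using L_irrefl by blast
lemma L_unique2: "\<lbrakk>L b a; L c a\<rbrakk> \<Longrightarrow> b = c" using L_unique L_sym by blast

definition adj :: "'v \<Rightarrow> 'v \<Rightarrow> bool" where "adj a b \<longleftrightarrow> S a b \<or> L a b"

definition edges :: "'v set set" where "edges = {{a, b} |a b. adj a b}"

text \<open>In a trimmed configuration the short neighbours of both ends of a long edge lie on one
  side of its great circle (\<open>long_edge_one_sided\<close>). \<open>ori\<close> names the order
  of the ends for which this is the negative side.\<close>

definition ori :: "'v \<Rightarrow> 'v \<Rightarrow> bool" where
  "ori u w \<longleftrightarrow> L u w \<and> (\<forall>x. S u x \<or> S w x \<longrightarrow> \<Delta> u w x < 0)"

lemma oriD: "ori u w \<Longrightarrow> L u w" "ori u w \<Longrightarrow> S u x \<Longrightarrow> \<Delta> u w x < 0" "ori u w \<Longrightarrow> S w x \<Longrightarrow> \<Delta> u w x < 0"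
  by (auto simp: ori_def)

lemma adj_sym: "adj a b \<Longrightarrow> adj b a" by (auto simp: adj_def S_sym L_sym)
lemma adj_in: "adj a b \<Longrightarrow> a \<in> V" "adj a b \<Longrightarrow> b \<in> V"
  by (auto simp: adj_def intro: S_in L_in S_in2 L_in2)
lemma adj_neq: "adj a b \<Longrightarrow> a \<noteq> b" by (auto simp: adj_def S_irrefl L_irrefl)

lemma edges_in: "e \<in> edges \<Longrightarrow> e \<subseteq> V" by (auto simp: edges_def adj_in)
lemma finite_edges: "finite edges"
  using finite_subset[of edges "Pow V"] finite_V edges_in by blast

text \<open>Makes every later result available with left and right exchanged; an oriented long edge
  is thereby reversed.\<close>

lemma mirror: "thrackle_configuration V (\<lambda>a b c. - \<Delta> a b c) S L"
proof -
  have neg: "\<alpha> * - a + \<beta> * - b = \<gamma> * - c + \<delta> * - d \<longleftrightarrow> \<alpha> * a + \<beta> * b = \<gamma> * c + \<delta> * d"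
    for \<alpha> \<beta> \<gamma> \<delta> a b c d :: real by (auto simp: algebra_simps)
  show ?thesis
    by (unfold_locales, unfold neg)
      (fact finite_V, metis rotate, metis swap, metis general_position neg_equal_0_iff_equal,
        fact S_sym, fact L_sym, fact S_in, fact L_in, fact S_irrefl, fact L_irrefl, fact not_S_L,
        fact L_unique, fact cross_SS, fact cross_LS, fact cross_LL)
qed

text \<open>The functional \<open>\<Delta> a b\<close> kills one side of the crossing relation, and
  the other two terms must cancel with positive coefficients. Evaluating a relation at a functional
  that kills one of the edges is the usual way to exploit a crossing below.\<close>

lemma short_edge_separates:
  assumes "adj a b" "S c d" "{a, b} \<inter> {c, d} = {}"
  shows "\<Delta> a b c > 0 \<longleftrightarrow> \<Delta> a b d < 0" "\<Delta> a b c < 0 \<longleftrightarrow> \<Delta> a b d > 0"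
proof -
  obtain \<alpha> \<beta> \<gamma> \<delta> where "\<gamma> > 0" "\<delta> > 0"
    and *: "\<And>x y. \<alpha> * \<Delta> x y a + \<beta> * \<Delta> x y b = \<gamma> * \<Delta> x y c + \<delta> * \<Delta> x y d"
  proof (cases "S a b")
    case True
    then show ?thesis using that cross_SS[OF True assms(2,3)] by blast
  next
    case False
    then have "L a b" using assms adj_def by blast
    then show ?thesis using that cross_LS[OF _ assms(2,3)] by blast
  qed
  moreover have "\<gamma> * \<Delta> a b c + \<delta> * \<Delta> a b d = 0" using *[of a b] by simp
  ultimately show "\<Delta> a b c > 0 \<longleftrightarrow> \<Delta> a b d < 0" "\<Delta> a b c < 0 \<longleftrightarrow> \<Delta> a b d > 0"
    using sign_of_cancellation by blast+
qed

text \<open>At \<open>u\<close> and \<open>w\<close> the determinant is zero, and \<open>ori\<close>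
  makes their short neighbours negative. So negative versus nonnegative is a proper two-colouring of
  the graph of short edges, with \<open>u\<close> and \<open>w\<close> included.\<close>

lemma ori_alternates:
  assumes "ori u w" "S x y"
  shows "\<Delta> u w x < 0 \<longleftrightarrow> \<not> \<Delta> u w y < 0"
proof (cases "{u, w} \<inter> {x, y} = {}")
  case True
  have "L u w" using assms oriD by blast
  then have "\<Delta> u w y \<noteq> 0" using True assms
    by (intro general_position) (auto intro: L_in L_in2 S_in2 L_neq simp: L_irrefl)
  then show ?thesis using short_edge_separates[of u w x y] \<open>L u w\<close> assms True by (auto simp: adj_def)
next
  case False
  then consider "x = u" | "x = w" | "y = u" | "y = w" by blast
  then show ?thesis using oriD(2,3)[OF assms(1)] assms(2) S_sym[OF assms(2)] by cases auto
qed

end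

locale trimmed_configuration = thrackle_configuration V \<Delta> S L
  for V :: "'v set" and \<Delta> S L +
  assumes two_neighbours: "v \<in> V \<Longrightarrow> \<exists>a b. a \<noteq> b \<and> adj v a \<and> adj v b"
begin

lemma other_neighbour:
  assumes "v \<in> V" obtains b where "b \<noteq> a" "adj v b"
  using two_neighbours[OF assms] by metis

lemma short_neighbour:
  assumes "L v a" obtains b where "S v b" "b \<noteq> a"
  using other_neighbour[OF L_in[OF assms], of a] assms L_unique unfolding adj_def by metis

text \<open>If \<open>x\<close> and \<open>y\<close> differ, \<open>ux\<close> and \<open>wy\<close>
  are disjoint short edges, and \<open>\<Delta> u w\<close> sees only \<open>x\<close> and
  \<open>y\<close> in their crossing relation, with positive coefficients on both sides.\<close>

lemma long_edge_one_sided: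
  assumes "L u w" "S u x" "S w y"
  shows "\<Delta> u w x * \<Delta> u w y > 0"
proof -
  have nx: "\<Delta> u w x \<noteq> 0" 
    using assms by (intro general_position) (auto intro: L_in L_in2 S_in2 dest: L_neq S_neq not_S_L L_sym)
  show ?thesis
  proof (cases "x = y")
    case True then show ?thesis using nx by (auto simp: zero_less_mult_iff)
  next
    case False
    then have "{u, x} \<inter> {w, y} = {}" using assms by (auto dest: L_neq S_neq not_S_L L_sym S_sym)
    then obtain \<alpha> \<beta> \<gamma> \<delta> where "\<beta> > 0" "\<delta> > 0"
      and *: "\<And>a b. \<alpha> * \<Delta> a b u + \<beta> * \<Delta> a b x = \<gamma> * \<Delta> a b w + \<delta> * \<Delta> a b y"
      using cross_SS[OF assms(2,3)] by meson
    then have "\<beta> * \<Delta> u w x = \<delta> * \<Delta> u w y" using *[of u w] by simp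
    from sign_of_balance[OF this \<open>\<beta> > 0\<close> \<open>\<delta> > 0\<close>] nx show ?thesis
      by (auto simp: zero_less_mult_iff)
  qed
qed

lemma ori_cases:
  assumes "L u w" shows "ori u w \<or> ori w u"
proof -
  obtain x where x: "S u x" using short_neighbour[OF assms] by blast
  obtain y where y: "S w y" using short_neighbour[OF L_sym[OF assms]] by blast
  have 1: "\<Delta> u w x * \<Delta> u w y' > 0" if "S w y'" for y' using long_edge_one_sided[OF assms x that] .
  have 2: "\<Delta> u w x' * \<Delta> u w y > 0" if "S u x'" for x' using long_edge_one_sided[OF assms that y] .
  show ?thesis
  proof (cases "\<Delta> u w x < 0")
    case True
    then have "\<Delta> u w y < 0" using 1[OF y] by (simp add: zero_less_mult_iff)
    then have "ori u w" using True 1 2 assms unfolding ori_def by (fastforce simp: zero_less_mult_iff)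
    then show ?thesis ..
  next
    case False
    then have "\<Delta> u w y > 0" "\<Delta> u w x > 0" using 1[OF y] by (auto simp: zero_less_mult_iff)
    then have "ori w u" using 1 2 L_sym[OF assms] unfolding ori_def by (fastforce simp: zero_less_mult_iff swap[of w u])
    then show ?thesis ..
  qed
qed

lemma ori_asym: "ori u w \<Longrightarrow> \<not> ori w u"
proof
  assume a: "ori u w" "ori w u"
  obtain x where "S u x" using short_neighbour oriD(1)[OF a(1)] by blast
  then show False using oriD(2)[OF a(1)] oriD(3)[OF a(2)] swap[of w u x] by fastforce
qed

lemma ori_from_neighbour: "\<lbrakk>L u w; S u x \<or> S w x; \<Delta> u w x < 0\<rbrakk> \<Longrightarrow> ori u w"
  using ori_cases[of u w] oriD(2,3)[of w u x] swap[of w u x] by fastforce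

section \<open>Marking leftmost edges\<close>

text \<open>A long arc leaves \<open>v\<close> in the direction away from \<open>a\<close>.\<close>

definition side :: "'v \<Rightarrow> 'v \<Rightarrow> real" where "side v a = (if L v a then -1 else 1)"

text \<open>The product is the determinant formed with the directions in which the edges leave
  \<open>v\<close>; it is negative when \<open>vb\<close> leaves to the right of \<open>va\<close>.
  These directions may wind around \<open>v\<close>, so a leftmost edge need not exist.\<close>

definition leftmost :: "'v \<Rightarrow> 'v \<Rightarrow> bool" where
  "leftmost v a \<longleftrightarrow> adj v a \<and> (\<forall>b. adj v b \<longrightarrow> b \<noteq> a \<longrightarrow> \<Delta> v a b * side v a * side v b < 0)"

lemma leftmost_unique: "\<lbrakk>leftmost v a; leftmost v b\<rbrakk> \<Longrightarrow> a = b"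
proof (rule ccontr)
  assume "leftmost v a" "leftmost v b" "a \<noteq> b"
  then have "\<Delta> v a b * side v a * side v b < 0" "\<Delta> v b a * side v b * side v a < 0"
    unfolding leftmost_def by metis+
  then show False by (simp add: swap_right[of v b a] mult.assoc mult.commute[of "side v a"])
qed

lemma leftmost_short: "\<lbrakk>leftmost v a; S v a; S v b; b \<noteq> a\<rbrakk> \<Longrightarrow> \<Delta> v a b < 0"
  using not_S_L by (fastforce simp: leftmost_def side_def adj_def)

text \<open>Hence a long edge never escapes the marking: the second end of its orientation marks
  it.\<close>

lemma leftmost_ori: "ori u w \<Longrightarrow> leftmost w u"
  unfolding leftmost_def
proof (intro conjI allI impI)
  assume o: "ori u w"
  then have L: "L w u" using oriD L_sym by blast
  then show "adj w u" by (simp add: adj_def)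
  fix b assume b: "adj w b" "b \<noteq> u"
  then have "S w b" using L L_unique adj_def by blast
  then show "\<Delta> w u b * side w u * side w b < 0"
    using oriD(3)[OF o] L not_S_L[of w b] by (auto simp: side_def swap[of w u])
qed

lemma ori_if_leftmost_long:
  assumes "leftmost v a" "L v a" shows "ori a v"
proof -
  obtain b where b: "S v b" "b \<noteq> a" using short_neighbour assms by blast
  then have "\<Delta> v a b * side v a * side v b < 0" using assms by (auto simp: leftmost_def adj_def)
  then have "\<Delta> v a b > 0" using assms b not_S_L[of v b] by (auto simp: side_def split: if_splits)
  then show ?thesis using ori_from_neighbour[of a v b] L_sym[OF assms(2)] b by (simp add: swap[of a v])
qed

lemma not_leftmost:
  assumes "adj v a" "\<not> leftmost v a"
  obtains b where "b \<noteq> a" "adj v b" "\<Delta> v a b * side v a * side v b > 0"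
proof -
  obtain b where b: "b \<noteq> a" "adj v b" "\<not> \<Delta> v a b * side v a * side v b < 0"
    using assms unfolding leftmost_def by blast
  have "\<Delta> v a b \<noteq> 0" using assms b adj_in adj_neq by (intro general_position) auto
  then have "\<Delta> v a b * side v a * side v b \<noteq> 0" by (simp add: side_def)
  then show ?thesis using that[OF b(1,2)] b(3) by linarith
qed

text \<open>If \<open>xa\<close> and \<open>yb\<close> leave the short edge \<open>xy\<close> on different sides, at least one of them is long.
  In the next two lemmas the crossing pattern puts one of the four points inside the spherical
  triangle of the other three, which limits how the further edge at \<open>a\<close> or \<open>b\<close> can leave it.\<close>

lemma unmarked_long_short:
  assumes S: "S x y" and L: "L x a" and b: "S y b" and ne: "a \<noteq> b" "b \<noteq> x"
    and sg: "\<Delta> x y a < 0" "\<Delta> x y b < 0"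
  shows "S a y"
proof (rule ccontr)
  assume nS: "\<not> S a y"
  obtain c where c: "S a c" "c \<noteq> x" using short_neighbour[OF L_sym[OF L]] by blast
  have cy: "c \<noteq> y" "c \<noteq> a" using nS c S_irrefl by auto
  have dist: "x \<noteq> y" "x \<noteq> a" "y \<noteq> b" "y \<noteq> a" using S L b S_irrefl L_irrefl not_S_L by blast+
  have oa: "ori a x"
    by (rule ori_from_neighbour[of a x y]) (use L_sym[OF L] S sg in \<open>simp_all add: rotate[of a x y]\<close>)
  obtain \<alpha> \<beta> \<gamma> \<delta> where e: "\<alpha> < 0 \<or> \<beta> < 0" "\<gamma> > 0" "\<delta> > 0"
    and E: "\<And>s t. \<alpha> * \<Delta> s t x + \<beta> * \<Delta> s t a = \<gamma> * \<Delta> s t y + \<delta> * \<Delta> s t b"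
    using cross_LS[OF L b] dist ne by auto
  have "\<beta> * \<Delta> x y a = \<delta> * \<Delta> x y b" using E[of x y] by simp
  then have "\<beta> > 0" using sign_of_balance[of "- \<Delta> x y a" \<beta> "- \<Delta> x y b" \<delta>] e sg by (simp add: mult.commute)
  \<comment> \<open>By \<open>E\<close>, \<open>a\<close> is now a positive combination of
    \<open>x\<close>, \<open>y\<close> and \<open>b\<close>, hence inside their spherical
    triangle.\<close>
  then have al: "\<alpha> < 0" using e by simp
  have "\<gamma> * \<Delta> x a y + \<delta> * \<Delta> x a b = 0" using E[of x a] by simp
  moreover have xay: "\<Delta> x a y > 0" using sg by (simp add: swap_right[of x a y])
  ultimately have xab: "\<Delta> x a b < 0" using sign_of_cancellation e by blast
  have xac: "\<Delta> x a c > 0" using oriD(2)[OF oa c(1)] by (simp add: swap[of x a])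
  then have cb: "c \<noteq> b" using xab by auto
  have ybx: "\<Delta> y b x < 0" using sg rotate[of x y b] by simp
  have "\<alpha> * \<Delta> y b x + \<beta> * \<Delta> y b a = 0" using E[of y b] by simp
  then have yba: "\<Delta> y b a < 0" using sign_of_cancellation[of "-\<alpha>" "- \<Delta> y b x" \<beta> "\<Delta> y b a"] al \<open>\<beta> > 0\<close> ybx by simp
  obtain k1 k2 k3 k4 where k: "k1 > 0" "k2 > 0" "k3 > 0" "k4 > 0"
    and K: "\<And>s t. k1 * \<Delta> s t a + k2 * \<Delta> s t c = k3 * \<Delta> s t x + k4 * \<Delta> s t y"
    using cross_SS[OF c(1) S] dist cy c by auto
  obtain n1 n2 n3 n4 where n: "n1 > 0" "n2 > 0" "n3 > 0" "n4 > 0"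
    and N: "\<And>s t. n1 * \<Delta> s t a + n2 * \<Delta> s t c = n3 * \<Delta> s t y + n4 * \<Delta> s t b"
    using cross_SS[OF c(1) b] dist cy cb ne by auto
  \<comment> \<open>The arc from \<open>a\<close> to \<open>c\<close> would have to leave this
    triangle both through \<open>xy\<close> and through \<open>yb\<close>. By
    \<open>\<Delta> x y\<close> the point on \<open>xy\<close> comes later along the arc, by
    \<open>\<Delta> y b\<close> the point on \<open>yb\<close> does.\<close>
  have k1: "k1 * \<Delta> x y a + k2 * \<Delta> x y c = 0" and k2: "k1 * \<Delta> y b a + k2 * \<Delta> y b c < 0"
    using K[of x y] K[of y b] k ybx by (auto simp: mult_pos_neg)
  have n1: "n1 * \<Delta> x y a + n2 * \<Delta> x y c < 0" and n2: "n1 * \<Delta> y b a + n2 * \<Delta> y b c = 0"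
    using N[of x y] N[of y b] n sg by (auto simp: mult_pos_neg)
  have "k1 * n2 * \<Delta> x y a + k2 * n2 * \<Delta> x y c = 0"
    using arg_cong[OF k1, of "\<lambda>z. n2 * z"] by (simp add: algebra_simps)
  moreover have "k2 * n1 * \<Delta> x y a + k2 * n2 * \<Delta> x y c < 0"
    using mult_pos_neg[OF k(2) n1] by (simp add: algebra_simps)
  ultimately have "(k1 * n2 - k2 * n1) * \<Delta> x y a > 0" by (simp add: algebra_simps)
  then have "k1 * n2 < k2 * n1" using sg(1) by (simp add: zero_less_mult_iff)
  moreover have "k1 * n2 * \<Delta> y b a + k2 * n2 * \<Delta> y b c < 0"
    using mult_pos_neg[OF n(2) k2] by (simp add: algebra_simps)
  moreover have "k2 * n1 * \<Delta> y b a + k2 * n2 * \<Delta> y b c = 0"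
    using arg_cong[OF n2, of "\<lambda>z. k2 * z"] by (simp add: algebra_simps)
  ultimately have "(k1 * n2 - k2 * n1) * \<Delta> y b a < 0" by (simp add: algebra_simps)
  then show False using yba \<open>k1 * n2 < k2 * n1\<close> by (simp add: mult_less_0_iff)
qed

lemma unmarked_long_long:
  assumes S: "S x y" and L: "L x a" and b: "L y b" and ne: "a \<noteq> b"
    and sg: "\<Delta> x y a < 0" "\<Delta> x y b > 0"
    and c: "\<alpha> > 0" "\<beta> > 0" "\<gamma> > 0" "\<delta> < 0"
    and E: "\<And>s t. \<alpha> * \<Delta> s t x + \<beta> * \<Delta> s t a = \<gamma> * \<Delta> s t y + \<delta> * \<Delta> s t b"
  shows "S b x"
proof (rule ccontr)
  assume nS: "\<not> S b x"
  obtain e where e: "S b e" "e \<noteq> y" using short_neighbour[OF L_sym[OF b]] by blast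
  have ex: "e \<noteq> x" "e \<noteq> b" using nS e S_irrefl by auto
  have dist: "x \<noteq> y" "x \<noteq> a" "y \<noteq> b" "y \<noteq> a" "x \<noteq> b" using S L b S_irrefl L_irrefl not_S_L S_sym by blast+
  have ob: "ori b y"
    by (rule ori_from_neighbour[of b y x]) (use L_sym[OF b] S_sym[OF S] sg in \<open>simp_all add: rotate[of b y x] swap[of y x]\<close>)
  have ybx: "\<Delta> y b x > 0" using sg rotate[of x y b] by simp
  have xay: "\<Delta> x a y > 0" using sg by (simp add: swap_right[of x a y])
  have ybe: "\<Delta> y b e > 0" using oriD(2)[OF ob e(1)] by (simp add: swap[of y b])
  \<comment> \<open>Solved for \<open>y\<close>, the relation \<open>E\<close> puts \<open>y\<close>
    inside the spherical triangle of \<open>x\<close>, \<open>a\<close> and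
    \<open>b\<close>.\<close>
  have "\<gamma> * \<Delta> x a y + \<delta> * \<Delta> x a b = 0" using E[of x a] by simp
  then have xab: "\<Delta> x a b > 0" using c xay sign_of_cancellation[of \<gamma> "\<Delta> x a y" "-\<delta>" "- \<Delta> x a b"] by simp
  have "\<alpha> * \<Delta> y b x + \<beta> * \<Delta> y b a = 0" using E[of y b] by simp
  then have yba: "\<Delta> y b a < 0" using sign_of_cancellation c ybx by blast
  obtain l1 l2 l3 l4 where l: "l1 > 0" "l2 > 0" "l3 > 0" "l4 > 0"
    and EL: "\<And>s t. l1 * \<Delta> s t b + l2 * \<Delta> s t e = l3 * \<Delta> s t x + l4 * \<Delta> s t y"
    using cross_SS[OF e(1) S] dist ex e by auto
  show False
  proof (cases "e = a")
    case True
    then have "l2 * \<Delta> y b a = l3 * \<Delta> y b x" using EL[of y b] by simp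
    from sign_of_balance(1)[OF this l(2,3)] show False using yba ybx by simp
  next
    case False
    obtain m1 m2 m3 m4 where m: "m3 < 0 \<or> m4 < 0" "m1 > 0" "m2 > 0"
      and M: "\<And>s t. m3 * \<Delta> s t x + m4 * \<Delta> s t a = m1 * \<Delta> s t b + m2 * \<Delta> s t e"
      using cross_LS[OF L e(1)] dist ex False ne by auto
    have 1: "m1 * \<Delta> x a b + m2 * \<Delta> x a e = 0" using M[of x a] by simp
    have 2: "l1 * \<Delta> x a b + l2 * \<Delta> x a e > 0" using EL[of x a] l xay by simp
    have 3: "l1 * \<Delta> x y b + l2 * \<Delta> x y e = 0" using EL[of x y] by simp
    have "l2 * m1 * \<Delta> x a b + l2 * m2 * \<Delta> x a e = 0"
      using arg_cong[OF 1, of "\<lambda>z. l2 * z"] by (simp add: algebra_simps)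
    moreover have "l1 * m2 * \<Delta> x a b + l2 * m2 * \<Delta> x a e > 0"
      using mult_pos_pos[OF m(3) 2] by (simp add: algebra_simps)
    ultimately have "(l1 * m2 - l2 * m1) * \<Delta> x a b > 0" by (simp add: algebra_simps)
    \<comment> \<open>From \<open>b\<close> to \<open>e\<close> the circle of \<open>xa\<close> is
      met after \<open>xy\<close>. At that point this makes the coefficients of \<open>x\<close> and
      \<open>a\<close> both positive, so the point is on the short arc between them and not on the
      long edge.\<close>
    then have lm: "l1 * m2 - l2 * m1 > 0" using xab by (simp add: zero_less_mult_iff)
    have "l1 * m2 * \<Delta> x y b + l2 * m2 * \<Delta> x y e = 0"
      using arg_cong[OF 3, of "\<lambda>z. m2 * z"] by (simp add: algebra_simps)
    then have "l2 * (m1 * \<Delta> x y b + m2 * \<Delta> x y e) = - ((l1 * m2 - l2 * m1) * \<Delta> x y b)"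
      by (simp add: algebra_simps)
    then have "l2 * (m1 * \<Delta> x y b + m2 * \<Delta> x y e) < 0" using lm sg(2) by simp
    then have "m4 * \<Delta> x y a < 0" using M[of x y] l by (simp add: mult_less_0_iff)
    then have m4: "m4 > 0" using sg(1) by (simp add: mult_less_0_iff)
    have "m3 * \<Delta> y b x = m2 * \<Delta> y b e - m4 * \<Delta> y b a" using M[of y b] by simp
    moreover have "m2 * \<Delta> y b e > 0" "m4 * \<Delta> y b a < 0" using m4 m ybe yba by (auto simp: mult_pos_neg)
    ultimately have "m3 * \<Delta> y b x > 0" by simp
    then have "m3 > 0" using ybx by (simp add: zero_less_mult_iff)
    then show False using m m4 by simp
  qed
qed

definition long_triangle :: "'v \<Rightarrow> 'v \<Rightarrow> 'v \<Rightarrow> bool" where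
  "long_triangle u w t \<longleftrightarrow> ori u w \<and> S w t \<and> S u t"

text \<open>Long edges are marked, so \<open>xy\<close> is short. The edges \<open>xa\<close> and
  \<open>yb\<close> that prevent it from being leftmost at its two ends leave it on different sides,
  so one of them is long, and it becomes the long side of the triangle.\<close>

lemma unmarked_edge:
  assumes "adj x y" "\<not> leftmost x y" "\<not> leftmost y x"
  shows "(\<exists>u. long_triangle u x y) \<or> (\<exists>u. long_triangle u y x)"
proof -
  have nL: "\<not> L x y"
    using ori_cases[of x y] leftmost_ori[of x y] leftmost_ori[of y x] assms by blast
  then have S: "S x y" "S y x" using assms adj_def S_sym by blast+
  then have nL2: "\<not> L y x" using L_sym nL by blast
  obtain a where a: "a \<noteq> y" "adj x a" "\<Delta> x y a * side x a > 0"
    using not_leftmost[OF assms(1,2)] nL by (auto simp: side_def)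
  obtain b where b: "b \<noteq> x" "adj y b" "\<Delta> y x b * side y b > 0"
    using not_leftmost[OF adj_sym[OF assms(1)] assms(3)] nL2 by (auto simp: side_def)
  have b': "\<Delta> x y b * side y b < 0" using b(3) by (simp add: swap[of y x])
  have ori_ax: "ori a x" if "L x a" "\<Delta> x y a < 0"
    by (rule ori_from_neighbour[of a x y]) (use that S L_sym in \<open>simp_all add: rotate[of a x y]\<close>)
  have ori_by: "ori b y" if "L y b" "\<Delta> x y b > 0"
    by (rule ori_from_neighbour[of b y x]) (use that S L_sym in \<open>simp_all add: rotate[of b y x] swap[of y x]\<close>)
  have xa: "x \<noteq> a" "y \<noteq> b" "x \<noteq> y" using a b adj_neq assms by blast+
  consider "S x a" "S y b" | "L x a" "S y b" | "S x a" "L y b" | "L x a" "L y b"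
    using a(2) b(2) adj_def by blast
  then show ?thesis
  proof cases
    case 1
    then have sg: "\<Delta> x y a > 0" "\<Delta> x y b < 0" using a b' not_S_L by (auto simp: side_def split: if_splits)
    then have ab: "a \<noteq> b" by auto
    obtain \<alpha> \<beta> \<gamma> \<delta> where e: "\<beta> > 0" "\<delta> > 0"
      and E: "\<And>s t. \<alpha> * \<Delta> s t x + \<beta> * \<Delta> s t a = \<gamma> * \<Delta> s t y + \<delta> * \<Delta> s t b"
      using cross_SS[OF 1] xa ab a b by auto
    have "\<beta> * \<Delta> x y a = \<delta> * \<Delta> x y b" using E[of x y] by simp
    from sign_of_balance(1)[OF this e] show ?thesis using sg by simp
  next
    case 2
    then have sg: "\<Delta> x y a < 0" "\<Delta> x y b < 0" using a b' not_S_L by (auto simp: side_def split: if_splits)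
    have "S a y"
      using unmarked_long_short[OF S(1) 2 _ b(1) sg] 2 S_sym by (cases "a = b") auto
    then show ?thesis using ori_ax 2 sg S unfolding long_triangle_def by blast
  next
    case 3
    then have sg: "\<Delta> x y a > 0" "\<Delta> x y b > 0" using a b' not_S_L by (auto simp: side_def split: if_splits)
    have "S b x"
      using unmarked_long_short[OF S(2) 3(2,1) _ a(1)] sg 3 S_sym
      by (cases "a = b") (auto simp: swap[of y x])
    then show ?thesis using ori_by 3 sg S unfolding long_triangle_def by blast
  next
    case 4
    then have sg: "\<Delta> x y a < 0" "\<Delta> x y b > 0" using a b' not_S_L by (auto simp: side_def split: if_splits)
    then have ab: "a \<noteq> b" by auto
    obtain \<alpha> \<beta> \<gamma> \<delta> where
      e: "\<alpha> > 0 \<and> \<beta> > 0 \<and> (\<gamma> > 0 \<or> \<delta> > 0) \<or> \<gamma> > 0 \<and> \<delta> > 0 \<and> (\<alpha> > 0 \<or> \<beta> > 0)"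
      and E: "\<And>s t. \<alpha> * \<Delta> s t x + \<beta> * \<Delta> s t a = \<gamma> * \<Delta> s t y + \<delta> * \<Delta> s t b"
      using cross_LL[OF 4] xa ab a b by auto
    have "\<beta> * \<Delta> x y a = \<delta> * \<Delta> x y b" using E[of x y] by simp
    then have bd: "\<beta> > 0 \<longleftrightarrow> \<delta> < 0" "\<beta> < 0 \<longleftrightarrow> \<delta> > 0"
      using sign_of_cancellation[of "- \<Delta> x y a" \<beta> "\<Delta> x y b" \<delta>] sg by (simp_all add: mult.commute)
    show ?thesis
    \<comment> \<open>The sign of \<beta> tells which of \<open>y\<close> and \<open>x\<close> lies
      inside the spherical triangle of the other three points; the long edge at this inner point
      closes the long triangle.\<close>
    proof (cases "\<beta> > 0")
      case True
      then have "S b x" using unmarked_long_long[OF S(1) 4 ab sg _ _ _ _ E] e bd by linarith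
      then show ?thesis using ori_by 4 sg S unfolding long_triangle_def by blast
    next
      case False
      have sg': "\<Delta> y x b < 0" "\<Delta> y x a > 0" using sg by (simp_all add: swap[of y x])
      have "S a y"
        using unmarked_long_long[OF S(2) 4(2,1) ab[symmetric] sg' _ _ _ _ E[symmetric]] e bd False by linarith
      then show ?thesis using ori_ax 4 sg S unfolding long_triangle_def by blast
    qed
  qed
qed

end

lemma finite_orbit_cycle:
  assumes "finite D" "x0 \<in> D" "\<And>x. x \<in> D \<Longrightarrow> f x \<in> D"
  shows "\<exists>x\<in>D. \<exists>k>0. (f ^^ k) x = x"
proof -
  have D: "(f ^^ i) x0 \<in> D" for i by (induction i) (auto simp: assms)
  have "\<not> inj (\<lambda>i. (f ^^ i) x0)"
    using D assms(1) by (metis finite_subset image_subsetI infinite_UNIV_nat finite_imageD)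
  then obtain i j where "i \<noteq> j" "(f ^^ i) x0 = (f ^^ j) x0" unfolding inj_on_def by blast
  then obtain i j where ij: "i < j" "(f ^^ i) x0 = (f ^^ j) x0" by (metis linorder_neqE_nat)
  then have "(f ^^ (j - i)) ((f ^^ i) x0) = (f ^^ i) x0"
    by (metis comp_apply funpow_add le_add_diff_inverse2 less_imp_le)
  then show ?thesis using D ij(1) zero_less_diff by blast
qed

section \<open>Pairs of disjoint long edges and the count of marked edges\<close>

context thrackle_configuration
begin

text \<open>As \<open>a\<close> and \<open>b\<close> are on one side of \<open>cd\<close>, the
  functional \<open>\<Delta> c d\<close> forces opposite signs on \<alpha> and \<beta>, which leaves
  only the second alternative of \<open>cross_LL\<close>. Towards \<open>ab\<close>, the long edge
  \<open>cd\<close> then behaves like a short one.\<close>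

lemma cross_LL_one_sided:
  assumes "L a b" "L c d" "{a, b} \<inter> {c, d} = {}" "\<Delta> c d a * \<Delta> c d b > 0"
  obtains \<alpha> \<beta> \<gamma> \<delta> where "\<alpha> * \<beta> < 0" "\<gamma> > 0" "\<delta> > 0"
    "\<And>x y. \<alpha> * \<Delta> x y a + \<beta> * \<Delta> x y b = \<gamma> * \<Delta> x y c + \<delta> * \<Delta> x y d"
proof -
  obtain \<alpha> \<beta> \<gamma> \<delta> where
    e: "\<alpha> > 0 \<and> \<beta> > 0 \<and> (\<gamma> > 0 \<or> \<delta> > 0) \<or> \<gamma> > 0 \<and> \<delta> > 0 \<and> (\<alpha> > 0 \<or> \<beta> > 0)"
    and E: "\<And>x y. \<alpha> * \<Delta> x y a + \<beta> * \<Delta> x y b = \<gamma> * \<Delta> x y c + \<delta> * \<Delta> x y d"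
    using cross_LL[OF assms(1-3)] by blast
  have 0: "\<alpha> * \<Delta> c d a + \<beta> * \<Delta> c d b = 0" using E[of c d] by simp
  have s: "\<alpha> > 0 \<longleftrightarrow> \<beta> < 0" "\<alpha> < 0 \<longleftrightarrow> \<beta> > 0"
  proof -
    consider "\<Delta> c d a > 0" "\<Delta> c d b > 0" | "- \<Delta> c d a > 0" "- \<Delta> c d b > 0"
      using assms(4) by (auto simp: zero_less_mult_iff)
    then have "(\<alpha> > 0 \<longleftrightarrow> \<beta> < 0) \<and> (\<alpha> < 0 \<longleftrightarrow> \<beta> > 0)"
      using sign_of_coefficients[of \<alpha> "\<Delta> c d a" \<beta> "\<Delta> c d b"]
        sign_of_coefficients[of \<alpha> "- \<Delta> c d a" \<beta> "- \<Delta> c d b"] 0 by cases auto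
    then show "\<alpha> > 0 \<longleftrightarrow> \<beta> < 0" "\<alpha> < 0 \<longleftrightarrow> \<beta> > 0" by auto
  qed
  show ?thesis
    by (rule that[OF _ _ _ E]) (use e s in \<open>auto simp: mult_less_0_iff\<close>)
qed

lemma cross_LL_other_side:
  assumes "L a b" "L c d" "{a, b} \<inter> {c, d} = {}" "\<Delta> c d a * \<Delta> c d b > 0"
  shows "\<Delta> a b c > 0 \<longleftrightarrow> \<Delta> a b d < 0" "\<Delta> a b c < 0 \<longleftrightarrow> \<Delta> a b d > 0"
proof -
  obtain \<alpha> \<beta> \<gamma> \<delta> where e: "\<gamma> > 0" "\<delta> > 0"
    "\<And>x y. \<alpha> * \<Delta> x y a + \<beta> * \<Delta> x y b = \<gamma> * \<Delta> x y c + \<delta> * \<Delta> x y d"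
    using cross_LL_one_sided[OF assms] by metis
  have "\<gamma> * \<Delta> a b c + \<delta> * \<Delta> a b d = 0" using e(3)[of a b] by simp
  from sign_of_cancellation[OF this e(1,2)]
  show "\<Delta> a b c > 0 \<longleftrightarrow> \<Delta> a b d < 0" "\<Delta> a b c < 0 \<longleftrightarrow> \<Delta> a b d > 0" .
qed

lemma L_disjoint: "\<lbrakk>L a b; L c d; a \<noteq> c; a \<noteq> d\<rbrakk> \<Longrightarrow> {a, b} \<inter> {c, d} = {}"
  using L_unique L_sym by blast

lemma ori_nonzero: "\<lbrakk>ori u w; x \<in> V; x \<noteq> u; x \<noteq> w\<rbrakk> \<Longrightarrow> \<Delta> u w x \<noteq> 0"
  by (rule general_position) (auto dest: oriD(1) L_in L_in2 L_neq)

end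

context trimmed_configuration
begin

text \<open>With a common long edge, \<open>ut\<close> crosses \<open>wt'\<close> and
  \<open>ut'\<close> crosses \<open>wt\<close>, which gives contradictory signs of
  \<open>\<Delta> u t t'\<close>. If the long edges are disjoint, the ends of each have a common
  short neighbour and so lie on one side of the other, against
  \<open>cross_LL_other_side\<close>.\<close>

lemma long_triangle_unique:
  assumes T: "long_triangle u w t" and T': "long_triangle u' w' t'"
  shows "w = w' \<and> t = t'"
proof -
  have o: "ori u w" "S w t" "S u t" and o': "ori u' w'" "S w' t'" "S u' t'"
    using T T' by (auto simp: long_triangle_def)
  have L: "L u w" "L u' w'" using o o' oriD by auto
  show ?thesis
  proof (cases "u = u' \<or> u = w'")
    case True
    then have eq: "u = u'" "w = w'"
      using L L_sym L_unique o(1) o'(1) ori_asym by metis+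
    have "t = t'"
    proof (rule ccontr)
      assume tt: "t \<noteq> t'"
      have key: "\<Delta> u x y < 0" if xy: "S u x" "S w y" "x \<noteq> y" for x y
      proof -
        have "{u, x} \<inter> {w, y} = {}" using xy L o o' eq S_irrefl not_S_L L_sym S_sym L_irrefl by blast
        then obtain \<alpha> \<beta> \<gamma> \<delta> where e: "\<gamma> > 0" "\<delta> > 0"
          and E: "\<And>a b. \<alpha> * \<Delta> a b u + \<beta> * \<Delta> a b x = \<gamma> * \<Delta> a b w + \<delta> * \<Delta> a b y"
          using cross_SS[OF xy(1,2)] by blast
        have "\<gamma> * \<Delta> u x w + \<delta> * \<Delta> u x y = 0" using E[of u x] by simp
        moreover have "\<Delta> u x w > 0" using oriD(2)[OF o(1) xy(1)] by (simp add: swap_right[of u x w])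
        ultimately show ?thesis using sign_of_cancellation(1)[OF _ e] by blast
      qed
      have "\<Delta> u t t' < 0" "\<Delta> u t' t < 0" using key[of t t'] key[of t' t] o o' eq tt by auto
      then show False by (simp add: swap_right[of u t t'])
    qed
    then show ?thesis using eq by simp
  next
    case False
    have d: "{u, w} \<inter> {u', w'} = {}" "{u', w'} \<inter> {u, w} = {}" using L_disjoint[OF L] False by blast+
    have 1: "\<Delta> u w u' * \<Delta> u w w' > 0"
      using ori_alternates[OF o(1) o'(2)] ori_alternates[OF o(1) o'(3)]
        ori_nonzero[OF o(1) L_in[OF L(2)]] ori_nonzero[OF o(1) L_in2[OF L(2)]] d
      by (auto simp: zero_less_mult_iff)
    have 2: "\<Delta> u' w' u * \<Delta> u' w' w > 0"
      using ori_alternates[OF o'(1) o(2)] ori_alternates[OF o'(1) o(3)]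
        ori_nonzero[OF o'(1) L_in[OF L(1)]] ori_nonzero[OF o'(1) L_in2[OF L(1)]] d
      by (auto simp: zero_less_mult_iff)
    from cross_LL_other_side[OF L d(1) 2] 1 show ?thesis by (auto simp: zero_less_mult_iff)
  qed
qed

text \<open>Every vertex marks at most its leftmost edge, and only the edge \<open>wt\<close> of a long triangle can
  escape. So one edge too many forces every vertex to mark an edge, and no edge to be marked twice.\<close>

lemma excess_marking:
  assumes "card V < card edges"
  obtains u w t f where "long_triangle u w t" "\<And>v. v \<in> V \<Longrightarrow> leftmost v (f v)" "\<And>v. v \<in> V \<Longrightarrow> f (f v) \<noteq> v"
proof -
  define f where "f v = (SOME a. leftmost v a)" for v
  define U where "U = {v \<in> V. \<exists>a. leftmost v a}"
  define M where "M = (\<lambda>v. {v, f v}) ` U"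
  have f: "leftmost v (f v)" if "leftmost v a" for v a using that unfolding f_def by (rule someI)
  have U: "finite U" "U \<subseteq> V" using finite_V by (auto simp: U_def)
  have cM: "card M \<le> card U" "card U \<le> card V" "finite M"
    using U finite_V card_image_le by (auto simp: M_def intro: card_mono)
  have marked: "{x, y} \<in> M" if "leftmost x y" for x y
    using that f[OF that] leftmost_unique adj_in[of x y] unfolding M_def U_def leftmost_def by blast
  have un: "e \<in> M \<or> (\<exists>u w t. long_triangle u w t \<and> e = {w, t})" if e: "e \<in> edges" for e
  proof -
    obtain x y where "e = {x, y}" "adj x y" using e by (auto simp: edges_def)
    then show ?thesis using unmarked_edge[of x y] marked[of x y] marked[of y x] by (metis insert_commute)
  qed
  have "\<exists>u w t. long_triangle u w t"
  proof (rule ccontr)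
    assume "\<not> ?thesis"
    then have "edges \<subseteq> M" using un by blast
    from card_mono[OF cM(3) this] show False using cM assms by linarith
  qed
  then obtain u w t where T: "long_triangle u w t" by blast
  have "edges \<subseteq> insert {w, t} M" using un long_triangle_unique[OF T] by blast
  then have "card edges \<le> card (insert {w, t} M)" using cM(3) by (simp add: card_mono)
  also have "\<dots> \<le> Suc (card M)" using cM(3) by (simp add: card_insert_if)
  finally have "card edges \<le> Suc (card M)" .
  then have eq: "card M = card U" "card U = card V" using cM assms by auto
  then have UV: "U = V" using U finite_V card_subset_eq by blast
  have inj: "inj_on (\<lambda>v. {v, f v}) V" using eq eq_card_imp_inj_on[OF U(1)] UV unfolding M_def by simp
  have lm: "leftmost v (f v)" if "v \<in> V" for v using that UV f unfolding U_def by blast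
  have "f (f v) \<noteq> v" if "v \<in> V" for v
  proof
    assume a: "f (f v) = v"
    have "adj v (f v)" using lm[OF that] leftmost_def by blast
    then have "f v \<in> V" "v \<noteq> f v" using adj_in adj_neq by auto
    then show False using inj_onD[OF inj, of v "f v"] that a by (auto simp: insert_commute)
  qed
  then show ?thesis using that T lm by blast
qed

section \<open>The parity argument on a cycle of leftmost edges\<close>

text \<open>Otherwise \<open>wu\<close> is the only long leftmost edge that starts in the short
  component of \<open>t\<close>, so leftmost edges stay there and close up to a cycle. The circle of
  \<open>uw\<close> fixes the parity of its length, and the circle of its first edge contradicts
  this parity.\<close>

lemma cycle_meets_long_edge:
  assumes T: "long_triangle u w t"
    and lm: "\<And>v. v \<in> V \<Longrightarrow> leftmost v (f v)" and nf: "\<And>v. v \<in> V \<Longrightarrow> f (f v) \<noteq> v"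
  shows "\<exists>p p'. S\<^sup>*\<^sup>* t p \<and> p \<noteq> w \<and> ori p' p"
proof (rule ccontr)
  assume "\<not> ?thesis"
  then have no: "\<not> ori p' p" if "S\<^sup>*\<^sup>* t p" "p \<noteq> w" for p p' using that by blast
  define D where "D = {x. S\<^sup>*\<^sup>* t x}"
  have o: "ori u w" "S w t" "S u t" using T by (auto simp: long_triangle_def)
  have tV: "t \<in> V" using o S_in2 by blast
  have DV: "D \<subseteq> V"
  proof
    fix x assume "x \<in> D"
    then have "S\<^sup>*\<^sup>* t x" by (simp add: D_def)
    then show "x \<in> V" by (induction) (auto intro: tV S_in2)
  qed
  have short: "S v (f v)" if "v \<in> D" "v \<noteq> w" for v
  proof -
    have "leftmost v (f v)" using lm DV that by blast
    then have "adj v (f v)" "L v (f v) \<Longrightarrow> ori (f v) v"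
      by (auto simp: leftmost_def intro: ori_if_leftmost_long)
    then show ?thesis using no that unfolding D_def adj_def by blast
  qed
  have uD: "u \<in> D" and wD: "w \<in> D" using o S_sym unfolding D_def by blast+
  have fw: "f w = u" using leftmost_unique[OF lm leftmost_ori[OF o(1)]] wD DV by blast
  have fD: "f v \<in> D" if "v \<in> D" for v
    using that short[OF that] fw uD unfolding D_def by (cases "v = w") (auto intro: rtranclp.rtrancl_into_rtrancl)
  \<comment> \<open>A cycle through \<open>w\<close> is started at \<open>u = f w\<close>; then only
    its last edge can be long. The least period keeps \<open>x\<close> from recurring
    earlier.\<close>
  have "\<exists>x\<in>D. \<exists>k>0. (f ^^ k) x = x \<and> (\<forall>i. Suc i < k \<longrightarrow> (f ^^ i) x \<noteq> w) \<and> (\<forall>i. 0 < i \<and> i < k \<longrightarrow> (f ^^ i) x \<noteq> x)"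
  proof -
    have least: "\<exists>k>0. (f ^^ k) x = x \<and> (\<forall>i. 0 < i \<and> i < k \<longrightarrow> (f ^^ i) x \<noteq> x)"
      if "k > 0" "(f ^^ k) x = x" for x and k :: nat
      using exists_least_iff[of "\<lambda>k. k > 0 \<and> (f ^^ k) x = x"] that by metis
    show ?thesis
    proof (cases "\<exists>k>0. (f ^^ k) u = u")
      case True
      then obtain k where k: "k > 0" "(f ^^ k) u = u" "\<forall>i. 0 < i \<and> i < k \<longrightarrow> (f ^^ i) u \<noteq> u"
        using least by blast
      have "(f ^^ i) u \<noteq> w" if "Suc i < k" for i
      proof
        assume "(f ^^ i) u = w"
        then have "(f ^^ Suc i) u = u" using fw by simp
        then show False using k(3) that by blast
      qed
      then show ?thesis using k uD by blast
    next
      case False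
      obtain x k where x: "x \<in> D" "k > 0" "(f ^^ k) x = x"
        using finite_orbit_cycle[of D t f] fD finite_subset[OF DV finite_V] unfolding D_def by blast
      obtain l where l: "l > 0" "(f ^^ l) x = x" "\<forall>i. 0 < i \<and> i < l \<longrightarrow> (f ^^ i) x \<noteq> x"
        using least[OF x(2,3)] by blast
      have "(f ^^ i) x \<noteq> w" for i
      proof
        assume "(f ^^ i) x = w"
        then have u: "u = (f ^^ Suc i) x" using fw by simp
        have "(f ^^ l) u = (f ^^ Suc i) ((f ^^ l) x)" unfolding u by (metis add.commute comp_apply funpow_add)
        then have "(f ^^ l) u = u" using l u by simp
        then show False using False l by blast
      qed
      then show ?thesis using x l by blast
    qed
  qed
  then obtain x k where x: "x \<in> D" "k > 0" "(f ^^ k) x = x" "\<And>i. Suc i < k \<Longrightarrow> (f ^^ i) x \<noteq> w"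
    "\<And>i. 0 < i \<Longrightarrow> i < k \<Longrightarrow> (f ^^ i) x \<noteq> x" by metis
  define v where "v i = (f ^^ i) x" for i
  have v0: "v 0 = x" and vS: "v (Suc i) = f (v i)" and vk: "v k = x" for i using x by (auto simp: v_def)
  have vD: "v i \<in> D" for i by (induction i) (auto simp: v0 vS x fD)
  have vV: "v i \<in> V" for i using vD DV by blast
  have vf: "v (Suc i) \<noteq> v i" for i using lm[OF vV[of i]] adj_neq unfolding leftmost_def vS by metis
  have vff: "v (Suc (Suc i)) \<noteq> v i" for i using nf[OF vV[of i]] by (simp add: vS)
  have vx: "v i \<noteq> x" if "0 < i" "i < k" for i using x(5)[OF that] by (simp add: v_def)
  have sh: "S (v i) (v (Suc i))" if "Suc i < k" for i
    using short[OF vD[of i]] x(4)[OF that] by (simp add: vS v_def)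
  have k3: "k \<ge> 3"
  proof (rule ccontr)
    assume "\<not> k \<ge> 3"
    then have "k = 1 \<or> k = 2" using x(2) by auto
    then show False using vf[of 0] vff[of 0] vk v0 by (auto simp: numeral_2_eq_2)
  qed
  \<comment> \<open>From a second occurrence \<open>v i = v 1\<close>, another \<open>k - 1\<close>
    steps lead to \<open>x\<close>. Modulo the period this is the index \<open>i - 1\<close>, too
    early for a return to \<open>x\<close>.\<close>
  have v1: "v i \<noteq> v 1" if "1 < i" "i < k" for i
  proof
    assume e: "v i = v 1"
    have "v (i + j) = v (1 + j)" for j by (induction j) (use e in \<open>auto simp: vS\<close>)
    from this[of "k - 1"] have "v (i + (k - 1)) = x" using x(2) vk by simp
    moreover have "v (k + j) = v j" for j by (induction j) (auto simp: vk v0 vS)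
    ultimately have "v (i - 1) = x" using that x(2) by (metis Nat.add_diff_assoc add.commute less_imp_le Suc_leI One_nat_def)
    then show False using vx[of "i - 1"] that by linarith
  qed
  have N: "\<Delta> u w (v i) < 0 \<longleftrightarrow> (\<Delta> u w x < 0 \<longleftrightarrow> even i)" if "i < k" for i
    using that
  proof (induction i)
    case (Suc i)
    then show ?case using ori_alternates[OF o(1) sh[of i]] by auto
  qed (simp add: v0)
  have adj1: "adj x (v 1)" "S x (v 1)" using sh[of 0] k3 by (auto simp: v0 adj_def)
  have v2: "\<Delta> x (v 1) (v 2) < 0"
  proof -
    have "leftmost (v 1) (v 2)" "S (v 1) (v 2)" using lm[OF vV[of 1]] sh[of 1] k3 by (auto simp: vS numeral_2_eq_2)
    then have "\<Delta> (v 1) (v 2) x < 0"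
      using leftmost_short[of "v 1" "v 2" x] adj1 S_sym vx[of 2] k3 by auto
    then show ?thesis using rotate by metis
  qed
  \<comment> \<open>The edges from \<open>v 2\<close> on to \<open>y\<close> are short and disjoint
    from the first edge, so each changes the side of it; the starting side comes from the leftmost
    edge at \<open>v 1\<close>.\<close>
  have alt: "if even i then \<Delta> x (v 1) (v i) < 0 else \<Delta> x (v 1) (v i) > 0" if "2 \<le> i" "i < k" for i
    using that
  proof (induction i rule: dec_induct)
    case (step i)
    have "{x, v 1} \<inter> {v i, v (Suc i)} = {}" using step v1[of i] v1[of "Suc i"] vx[of i] vx[of "Suc i"] by auto
    from short_edge_separates[OF adj1(1) sh this] step show ?case by (auto split: if_splits)
  qed (use v2 in simp)
  define y where "y = v (k - 1)"
  have fy: "f y = x" using vS[of "k - 1"] vk x(2) by (simp add: y_def)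
  have yN: "\<Delta> u w y < 0 \<longleftrightarrow> (\<Delta> u w x < 0 \<longleftrightarrow> even (k - 1))" using N[of "k - 1"] x(2) by (simp add: y_def)
  have ya: "if even (k - 1) then \<Delta> x (v 1) y < 0 else \<Delta> x (v 1) y > 0" 
    unfolding y_def by (rule alt) (use k3 in auto)
  show False
  \<comment> \<open>If the closing edge is \<open>wu\<close>, both its ends count as nonnegative for
    \<open>uw\<close>, so \<open>k - 1\<close> is even. Otherwise it is short and
    \<open>k - 1\<close> is odd. Either way \<open>alt\<close> puts \<open>y\<close> on the wrong
    side of the first edge.\<close>
  proof (cases "y = w")
    case True
    then have xu: "x = u" using fy fw by simp
    then have "even (k - 1)" using yN True by simp
    then have "\<Delta> u (v 1) w < 0" using ya True xu by simp
    moreover have "\<Delta> u w (v 1) < 0" using oriD(2)[OF o(1)] adj1 xu by simp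
    ultimately show False using swap_right[of u w "v 1"] by simp
  next
    case False
    then have Sy: "S y x" using short[of y] vD fy by (simp add: y_def)
    have "odd (k - 1)" using yN ori_alternates[OF o(1) Sy] by auto
    then have "\<Delta> x (v 1) y > 0" using ya by simp
    moreover have "\<Delta> x (v 1) y < 0"
      using leftmost_short[of x "v 1" y] lm[OF vV[of 0]] adj1 S_sym[OF Sy] v1[of "k - 1"] k3 by (auto simp: y_def v0 vS)
    ultimately show False by simp
  qed
qed

end

section \<open>The short component of a long triangle\<close>

text \<open>Read \<open>(y1, y2)\<close> and \<open>(v1, v2)\<close> as two points in coordinates
  with respect to the ends of an arc, and \<open>e1\<close>, \<open>e2\<close> as the values of a
  linear functional at these ends. If the functional vanishes at the first point, the order of the
  points, given by the determinant on the right, decides its sign at the second.\<close>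

lemma eliminate_second:
  fixes e1 e2 y1 y2 v1 v2 :: real
  assumes "y1 * e1 + y2 * e2 = 0"
  shows "y2 * (v1 * e1 + v2 * e2) = e1 * (y2 * v1 - v2 * y1)"
proof -
  have "y2 * (v1 * e1 + v2 * e2) = y2 * (v1 * e1 + v2 * e2) - v2 * (y1 * e1 + y2 * e2)"
    using assms by simp
  also have "\<dots> = e1 * (y2 * v1 - v2 * y1)" by (simp add: algebra_simps)
  finally show ?thesis .
qed

text \<open>Two functionals are positive at \<open>u\<close>. Each vanishes at one of the points
  \<open>(g, h)\<close>, \<open>(k, l)\<close> of the arc \<open>ut\<close> and is negative at the
  other, so each of the points would have to come after the other.\<close>

lemma no_interleaving:
  fixes g h k l du dt pu pt :: real
  assumes "g * du + h * dt < 0" "k * du + l * dt = 0" "du > 0"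
    and "g * pu + h * pt = 0" "k * pu + l * pt < 0" "pu > 0" and "g > 0" "h > 0" "k > 0" "l > 0"
  shows False
proof -
  have "du * (l * g - h * k) < 0"
    using eliminate_second[OF assms(2), of g h] assms by (metis mult_pos_neg)
  then have "l * g - h * k < 0" using assms by (simp add: mult_less_0_iff)
  moreover have "pu * (h * k - l * g) < 0"
    using eliminate_second[OF assms(4), of k l] assms by (metis mult_pos_neg)
  then have "h * k - l * g < 0" using assms by (simp add: mult_less_0_iff)
  ultimately show False by simp
qed

context thrackle_configuration
begin

text \<open>Two proper two-colourings of a connected graph agree everywhere or nowhere. This
  compares the sides of different great circles on the short component.\<close>

lemma component_alternation:
  assumes "S\<^sup>*\<^sup>* t x"
    and "\<And>a b. \<lbrakk>S\<^sup>*\<^sup>* t a; S\<^sup>*\<^sup>* t b; S a b\<rbrakk> \<Longrightarrow> A a \<longleftrightarrow> \<not> A b"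
    and "\<And>a b. \<lbrakk>S\<^sup>*\<^sup>* t a; S\<^sup>*\<^sup>* t b; S a b\<rbrakk> \<Longrightarrow> B a \<longleftrightarrow> \<not> B b"
  shows "(A x \<longleftrightarrow> B x) \<longleftrightarrow> (A t \<longleftrightarrow> B t)"
  using assms(1)
proof (induction)
  case (step y z)
  then have "S\<^sup>*\<^sup>* t z" by simp
  then show ?case using step assms(2)[of y z] assms(3)[of y z] by blast
qed simp

lemma component_ori:
  assumes "S\<^sup>*\<^sup>* t x" "S\<^sup>*\<^sup>* t y" "ori u w" "ori a b"
  shows "(\<Delta> u w x < 0 \<longleftrightarrow> \<Delta> a b x < 0) \<longleftrightarrow> (\<Delta> u w y < 0 \<longleftrightarrow> \<Delta> a b y < 0)"
  using component_alternation[OF assms(1), of "\<lambda>x. \<Delta> u w x < 0" "\<lambda>x. \<Delta> a b x < 0"]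
    component_alternation[OF assms(2), of "\<lambda>x. \<Delta> u w x < 0" "\<lambda>x. \<Delta> a b x < 0"]
    ori_alternates assms(3,4) by blast

lemma component_in_V: "\<lbrakk>S\<^sup>*\<^sup>* t x; t \<in> V\<rbrakk> \<Longrightarrow> x \<in> V"
  by (induction rule: rtranclp_induct) (auto intro: S_in2)

text \<open>All short edges of the component are disjoint from \<open>ab\<close>, so its circle
  two-colours the component; no vertex there is an end of \<open>ab\<close>, so no determinant
  vanishes.\<close>

lemma component_outer_edge:
  assumes "S\<^sup>*\<^sup>* t x" "S\<^sup>*\<^sup>* t y" "t \<in> V" "ori u w" "S a b" "\<not> S\<^sup>*\<^sup>* t a" "\<not> S\<^sup>*\<^sup>* t b"
  shows "(\<Delta> u w x < 0 \<longleftrightarrow> \<Delta> a b x > 0) \<longleftrightarrow> (\<Delta> u w y < 0 \<longleftrightarrow> \<Delta> a b y > 0)" "\<Delta> a b x \<noteq> 0"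
proof -
  have nz: "\<Delta> a b x \<noteq> 0" if "S\<^sup>*\<^sup>* t x" for x
    using assms(5-7) that component_in_V[OF that assms(3)]
    by (intro general_position) (auto intro: S_in S_in2 dest: S_neq)
  have alt: "\<Delta> a b c > 0 \<longleftrightarrow> \<not> \<Delta> a b d > 0" if c: "S\<^sup>*\<^sup>* t c" "S\<^sup>*\<^sup>* t d" "S c d" for c d
  proof -
    have "{a, b} \<inter> {c, d} = {}" using c assms by auto
    then show ?thesis using short_edge_separates(1)[of a b c d] assms(5) c nz[of d] by (auto simp: adj_def)
  qed
  show "(\<Delta> u w x < 0 \<longleftrightarrow> \<Delta> a b x > 0) \<longleftrightarrow> (\<Delta> u w y < 0 \<longleftrightarrow> \<Delta> a b y > 0)"
    using component_alternation[OF assms(1), of "\<lambda>x. \<Delta> u w x < 0" "\<lambda>x. \<Delta> a b x > 0"]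
    component_alternation[OF assms(2), of "\<lambda>x. \<Delta> u w x < 0" "\<lambda>x. \<Delta> a b x > 0"]
    ori_alternates[OF assms(4)] alt by blast
  show "\<Delta> a b x \<noteq> 0" using nz assms(1) by blast
qed

end

context trimmed_configuration
begin

lemma mirror_trimmed: "trimmed_configuration V (\<lambda>a b c. - \<Delta> a b c) S L"
proof -
  interpret m: thrackle_configuration V "\<lambda>a b c. - \<Delta> a b c" S L by (rule mirror)
  show ?thesis by unfold_locales (use two_neighbours in \<open>auto simp: adj_def m.adj_def\<close>)
qed

lemma long_triangle_component:
  assumes "long_triangle u w t"
  shows "t \<in> V" "S\<^sup>*\<^sup>* t u" "S\<^sup>*\<^sup>* t w" "S\<^sup>*\<^sup>* t t" "L u w" "ori u w" "S u t" "S w t" "\<Delta> u w t < 0"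
  using assms unfolding long_triangle_def by (auto intro: S_sym S_in2 oriD)

text \<open>On the other side, \<open>p\<close> would make the colourings by the circles of
  \<open>uw\<close> and \<open>pp'\<close> agree. This sends \<open>p'\<close> and its short
  neighbour \<open>d\<close> outside the component, and \<open>ut\<close> then meets
  \<open>pp'\<close> and \<open>p'd\<close> in two points whose order along \<open>ut\<close> is
  contradictory.\<close>

lemma long_endpoint_side:
  assumes T: "long_triangle u w t" and p: "S\<^sup>*\<^sup>* t p" "p \<noteq> u" "p \<noteq> w" "L p p'"
  shows "\<Delta> u w p < 0"
proof (rule ccontr)
  assume neg: "\<not> \<Delta> u w p < 0"
  note T' = long_triangle_component[OF T]
  obtain a b where ab: "ori a b" "a = p \<and> b = p' \<or> a = p' \<and> b = p" using ori_cases[OF p(4)] by blast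
  have disj: "{u, w} \<inter> {p, p'} = {}" using L_disjoint[OF T'(5) p(4)] p L_unique L_sym T' by blast
  have pV: "p \<in> V" "p' \<in> V" using p L_in L_in2 by auto
  have Nab: "\<Delta> u w x < 0 \<longleftrightarrow> \<Delta> a b x < 0" if "S\<^sup>*\<^sup>* t x" for x
    using component_ori[OF that p(1) T'(6) ab(1)] neg ab(2) by auto
  have abu: "\<Delta> a b u > 0" "\<Delta> a b w > 0" "\<Delta> a b t < 0"
    using Nab[OF T'(2)] Nab[OF T'(3)] Nab[OF T'(4)] T'(9)
      ori_nonzero[OF ab(1) L_in[OF T'(5)]] ori_nonzero[OF ab(1) L_in2[OF T'(5)]] disj ab(2) by fastforce+
  have up: "\<Delta> u w p > 0" using ori_nonzero[OF T'(6) pV(1)] p neg by linarith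
  have "\<Delta> p p' u * \<Delta> p p' w > 0"
    using abu(1,2) ab(2) swap[of p' p] by (auto simp: zero_less_mult_iff)
  from cross_LL_other_side[OF T'(5) p(4) disj this] up have up': "\<Delta> u w p' < 0" by simp
  have nD: "\<not> S\<^sup>*\<^sup>* t p'" using Nab[of p'] up' ab(2) by auto
  obtain d where d: "S p' d" "d \<noteq> p" using short_neighbour[OF L_sym[OF p(4)]] by blast
  have nDd: "\<not> S\<^sup>*\<^sup>* t d" using nD d(1) S_sym by (meson rtranclp.rtrancl_into_rtrancl)
  have abd: "\<Delta> a b d < 0" using oriD(2,3)[OF ab(1)] ab(2) d(1) by blast
  note out = component_outer_edge[OF _ _ T'(1,6) d(1) nD nDd]
  have \<Phi>: "\<Delta> p' d x > 0 \<longleftrightarrow> \<Delta> p' d p > 0" if "S\<^sup>*\<^sup>* t x" "\<not> \<Delta> u w x < 0" for x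
    using out(1)[OF that(1) p(1)] that neg by blast
  have \<Phi>u: "\<Delta> p' d u > 0 \<longleftrightarrow> \<Delta> p' d p > 0" using \<Phi>[OF T'(2)] by simp
  have \<Phi>t: "\<Delta> p' d t > 0 \<longleftrightarrow> \<not> \<Delta> p' d p > 0" using out(1)[OF T'(4) p(1)] neg T'(9) by blast
  have nz: "\<Delta> p' d u \<noteq> 0" "\<Delta> p' d t \<noteq> 0" "\<Delta> p' d p \<noteq> 0" using out(2) T' p(1) by blast+
  have "{p, p'} \<inter> {u, t} = {}" "{p', d} \<inter> {u, t} = {}"
    using disj nD nDd T' Nab[OF p(1)] abu neg by auto
  then obtain m1 m2 g h k1 k2 k l where
    m: "m1 < 0 \<or> m2 < 0" "g > 0" "h > 0" "k1 > 0" "k2 > 0" "k > 0" "l > 0"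
    and J: "\<And>x y. m1 * \<Delta> x y p + m2 * \<Delta> x y p' = g * \<Delta> x y u + h * \<Delta> x y t"
    and K: "\<And>x y. k1 * \<Delta> x y p' + k2 * \<Delta> x y d = k * \<Delta> x y u + l * \<Delta> x y t"
    using cross_LS[OF p(4) T'(7)] cross_SS[OF d(1) T'(7)] by metis
  have "m1 * \<Delta> u w p + m2 * \<Delta> u w p' < 0" using J[of u w] m T'(9) by (simp add: mult_pos_neg)
  \<comment> \<open>The crossing point is negative for \<open>uw\<close>, like \<open>t\<close>,
    while \<open>p\<close> is positive and \<open>p'\<close> negative. With \<open>m1\<close>
    nonnegative, \<open>m2\<close> would be negative and the value positive.\<close>
  then have m1: "m1 < 0"
    using m(1) up up' by (smt (verit, best) mult_neg_neg mult_nonneg_nonneg)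
  have J1: "g * \<Delta> p' d u + h * \<Delta> p' d t = m1 * \<Delta> p' d p" using J[of p' d] by simp
  have J2: "g * \<Delta> p' p u + h * \<Delta> p' p t = 0" using J[of p' p] by simp
  have K1: "k * \<Delta> p' d u + l * \<Delta> p' d t = 0" using K[of p' d] by simp
  have K2: "k * \<Delta> p' p u + l * \<Delta> p' p t = k2 * \<Delta> p' p d" using K[of p' p] by simp
  have dp: "\<Delta> p' d p = - \<Delta> p' p d" by (rule swap_right)
  \<comment> \<open>The two orientations of \<open>pp'\<close> differ by the sign of both
    functionals \<open>\<Delta> p' d\<close> and \<open>\<Delta> p' p\<close>, so the second case is
    the first one negated.\<close>
  from ab(2) show False
  proof
    assume "a = p' \<and> b = p"
    then have "\<Delta> p' p d < 0" "\<Delta> p' p u > 0" using abd abu by auto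
    moreover from this have "\<Delta> p' d p > 0" "\<Delta> p' d u > 0" using \<Phi>u dp by auto
    ultimately show False
      using no_interleaving[of g "\<Delta> p' d u" h "\<Delta> p' d t" k l "\<Delta> p' p u" "\<Delta> p' p t"] J1 J2 K1 K2 m m1
      by (simp add: mult_pos_neg mult_neg_pos)
  next
    assume "a = p \<and> b = p'"
    then have *: "\<Delta> p' p d > 0" "\<Delta> p' p u < 0" using abd abu swap[of p' p] by auto
    then have "\<Delta> p' d p < 0" "\<Delta> p' d u < 0" using \<Phi>u dp nz by auto
    then have "m1 * \<Delta> p' d p > 0" "k2 * \<Delta> p' p d > 0" using m m1 * by (simp_all add: mult_neg_neg)
    then have "g * - \<Delta> p' d u + h * - \<Delta> p' d t < 0" "k * - \<Delta> p' p u + l * - \<Delta> p' p t < 0"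
      using J1 K2 by linarith+
    then show False
      using no_interleaving[of g "- \<Delta> p' d u" h "- \<Delta> p' d t" k l "- \<Delta> p' p u" "- \<Delta> p' p t"] J2 K1 m *
        \<open>\<Delta> p' d u < 0\<close> by simp
  qed
qed

text \<open>\<open>(y1, y2)\<close> and \<open>(c1, c2)\<close> are the coordinates of the point where \<open>p'd\<close> crosses the great circle
  of \<open>uw\<close>, and \<open>(g1, g2)\<close>, \<open>(f1, f2)\<close> those of the point where the circles of \<open>pp'\<close> and \<open>uw\<close> meet.\<close>

lemma long_partner:
  assumes T: "long_triangle u w t" and p: "S\<^sup>*\<^sup>* t p" "p \<noteq> w" "ori p' p" and d: "S p' d"
  obtains g1 g2 f1 f2 y1 y2 c1 c2 where
    "p \<noteq> u" "\<Delta> u w p < 0" "\<not> S\<^sup>*\<^sup>* t p'" "\<not> S\<^sup>*\<^sup>* t d" "\<Delta> u w p' > 0" "\<Delta> u w d < 0"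
    "\<And>x. \<lbrakk>S\<^sup>*\<^sup>* t x; x \<noteq> p\<rbrakk> \<Longrightarrow> (\<Delta> p' p x < 0 \<longleftrightarrow> \<not> \<Delta> u w x < 0) \<and> \<Delta> p' p x \<noteq> 0"
    "\<And>x. S\<^sup>*\<^sup>* t x \<Longrightarrow> (\<Delta> p' d x > 0 \<longleftrightarrow> \<Delta> u w x < 0) \<and> \<Delta> p' d x \<noteq> 0"
    "g1 > 0" "g2 > 0" "f1 < 0" "f2 > 0"
    "\<And>x y. g1 * \<Delta> x y p + g2 * \<Delta> x y p' = f1 * \<Delta> x y u + f2 * \<Delta> x y w"
    "y1 > 0" "y2 > 0" "c1 < 0" "c2 > 0"
    "\<And>x y. y1 * \<Delta> x y p' + y2 * \<Delta> x y d = c1 * \<Delta> x y u + c2 * \<Delta> x y w"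
    "\<Delta> u t p' > 0" "\<Delta> w t p' > 0"
proof -
  note T' = long_triangle_component[OF T]
  have L: "L p p'" using oriD(1)[OF p(3)] L_sym by blast
  have pu: "p \<noteq> u"
  proof
    assume "p = u"
    then have "p' = w" using L T'(5) L_unique by blast
    then show False using p(3) \<open>p = u\<close> T'(6) ori_asym by blast
  qed
  have pN: "\<Delta> u w p < 0" using long_endpoint_side[OF T p(1) pu p(2) L] .
  have "u \<noteq> p'" using L_unique[OF T'(5)] L_sym[OF L] p(2) by blast
  then have disj: "{u, w} \<inter> {p', p} = {}" using L_disjoint[OF T'(5) L] pu by auto
  have pV: "p \<in> V" "p' \<in> V" using L L_in L_in2 by auto
  \<comment> \<open>\<open>p\<close> is negative for \<open>uw\<close> and zero for
    \<open>p'p\<close>, so the two colourings are opposite on the whole component.\<close>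
  have A: "\<Delta> p' p x < 0 \<longleftrightarrow> \<not> \<Delta> u w x < 0" if "S\<^sup>*\<^sup>* t x" for x
    using component_ori[OF that p(1) T'(6) p(3)] pN by auto
  have Auw: "\<Delta> p' p u < 0" "\<Delta> p' p w < 0" using A[OF T'(2)] A[OF T'(3)] by auto
  then have s: "\<Delta> p' p u * \<Delta> p' p w > 0" by (simp add: mult_neg_neg)
  have p'N: "\<Delta> u w p' > 0" using cross_LL_other_side[OF T'(5) L_sym[OF L] disj s] pN by simp
  have nD: "\<not> S\<^sup>*\<^sup>* t p'"
  proof
    assume "S\<^sup>*\<^sup>* t p'"
    then have "\<Delta> u w p' < 0" using long_endpoint_side[OF T _ _ _ L_sym[OF L]] disj by auto
    then show False using p'N by simp
  qed
  have nDd: "\<not> S\<^sup>*\<^sup>* t d" using nD d S_sym by (meson rtranclp.rtrancl_into_rtrancl)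
  have dN: "\<Delta> u w d < 0" using ori_alternates[OF T'(6) d] p'N by simp
  have Ad: "\<Delta> p' p d < 0" using oriD(2)[OF p(3) d] .
  then have \<Phi>p: "\<Delta> p' d p > 0" by (simp add: swap_right[of p' d p])
  have A': "(\<Delta> p' p x < 0 \<longleftrightarrow> \<not> \<Delta> u w x < 0) \<and> \<Delta> p' p x \<noteq> 0" if x: "S\<^sup>*\<^sup>* t x" "x \<noteq> p" for x
    using A[OF x(1)] ori_nonzero[OF p(3) component_in_V[OF x(1) T'(1)]] x nD by blast
  have \<Phi>: "(\<Delta> p' d x > 0 \<longleftrightarrow> \<Delta> u w x < 0) \<and> \<Delta> p' d x \<noteq> 0" if "S\<^sup>*\<^sup>* t x" for x
    using component_outer_edge[OF that p(1) T'(1,6) d nD nDd] \<Phi>p pN by blast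
  have \<Phi>uw: "\<Delta> p' d u < 0" "\<Delta> p' d w < 0" using \<Phi>[OF T'(2)] \<Phi>[OF T'(3)] by auto
  obtain f1 f2 g2 g1 where fg: "f1 * f2 < 0" "g2 > 0" "g1 > 0"
    and F: "\<And>x y. f1 * \<Delta> x y u + f2 * \<Delta> x y w = g2 * \<Delta> x y p' + g1 * \<Delta> x y p"
    using cross_LL_one_sided[OF T'(5) L_sym[OF L] disj s] by metis
  have f1: "f1 < 0"
  proof -
    have "f1 * \<Delta> w p u = g2 * \<Delta> w p p'" using F[of w p] by simp
    then have "f1 * \<Delta> u w p = g2 * \<Delta> p' p w * - 1"
      using rotate[of u w p] rotate[of w p p'] swap[of p p' w] by simp
    then have "f1 * \<Delta> u w p > 0" using fg Auw by (simp add: mult_pos_neg)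
    then show ?thesis using pN by (simp add: zero_less_mult_iff)
  qed
  then have f2: "f2 > 0" using fg(1) by (simp add: mult_less_0_iff)
  have "{u, w} \<inter> {p', d} = {}" using disj nDd T' by auto
  then obtain c1 c2 y1 y2 where cy: "y1 > 0" "y2 > 0"
    and Y: "\<And>x y. c1 * \<Delta> x y u + c2 * \<Delta> x y w = y1 * \<Delta> x y p' + y2 * \<Delta> x y d"
    using cross_LS[OF T'(5) d] by metis
  \<comment> \<open>\<open>\<Delta> p' d\<close> vanishes at the point \<open>(c1, c2)\<close> and
    \<open>\<Delta> p' p\<close> at \<open>(f1, f2)\<close>, and both are negative at
    \<open>u\<close> and \<open>w\<close>. Comparing the points through both functionals yields the
    signs of \<open>c2\<close> and \<open>c1\<close>.\<close>
  have Y\<Phi>: "c1 * \<Delta> p' d u + c2 * \<Delta> p' d w = 0" using Y[of p' d] by simp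
  have YA: "c1 * \<Delta> p' p u + c2 * \<Delta> p' p w < 0" using Y[of p' p] cy Ad by (simp add: mult_pos_neg)
  have F\<Phi>: "f1 * \<Delta> p' d u + f2 * \<Delta> p' d w > 0" using F[of p' d] fg \<Phi>p by simp
  have FA: "f1 * \<Delta> p' p u + f2 * \<Delta> p' p w = 0" using F[of p' p] by simp
  have "f2 * (c1 * \<Delta> p' p u + c2 * \<Delta> p' p w) < 0" using f2 YA by (simp add: mult_pos_neg)
  then have "\<Delta> p' p u * (f2 * c1 - c2 * f1) < 0" using eliminate_second[OF FA, of c1 c2] by simp
  then have 1: "f2 * c1 - c2 * f1 > 0" using Auw by (simp add: mult_less_0_iff)
  have 2: "c2 * (f1 * \<Delta> p' d u + f2 * \<Delta> p' d w) = \<Delta> p' d u * (c2 * f1 - f2 * c1)"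
    using eliminate_second[OF Y\<Phi>, of f1 f2] .
  have "\<Delta> p' d u * (c2 * f1 - f2 * c1) > 0" using 1 \<Phi>uw by (simp add: mult_neg_neg)
  then have "c2 * (f1 * \<Delta> p' d u + f2 * \<Delta> p' d w) > 0" using 2 by linarith
  then have c2: "c2 > 0" using zero_less_mult_pos2[OF _ F\<Phi>] by blast
  have c1: "c1 < 0"
    using sign_of_coefficients[of c1 "- \<Delta> p' d u" c2 "- \<Delta> p' d w"] Y\<Phi> \<Phi>uw c2 by simp
  \<comment> \<open>From \<open>p'\<close> to \<open>d\<close>, the edge \<open>at\<close> is met
    after the circle of \<open>uw\<close>. As \<open>\<Delta> a t\<close> is zero at the former
    point and positive at the latter, it is positive at \<open>p'\<close>.\<close>
  have \<tau>: "\<Delta> a t p' > 0" if a: "S a t" "S\<^sup>*\<^sup>* t a" "a = u \<or> a = w" "c1 * \<Delta> a t u + c2 * \<Delta> a t w > 0" for a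
  proof -
    have "{p', d} \<inter> {a, t} = {}" using nD nDd a T' by auto
    then obtain k1 k2 k3 k4 where k: "k1 > 0" "k2 > 0" "k3 > 0" "k4 > 0"
      and K: "\<And>x y. k1 * \<Delta> x y p' + k2 * \<Delta> x y d = k3 * \<Delta> x y a + k4 * \<Delta> x y t"
      using cross_SS[OF d a(1)] by metis
    have 1: "k1 * \<Delta> u w p' + k2 * \<Delta> u w d < 0" using K[of u w] k T'(9) a(3) by (auto simp: mult_pos_neg)
    have 2: "y1 * \<Delta> u w p' + y2 * \<Delta> u w d = 0" using Y[of u w] by simp
    have "\<Delta> u w p' * (y2 * k1 - k2 * y1) < 0"
      using eliminate_second[OF 2, of k1 k2] 1 cy by (metis mult_pos_neg)
    then have 3: "y2 * k1 - k2 * y1 < 0" using p'N by (simp add: mult_less_0_iff)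
    have 4: "k1 * \<Delta> a t p' + k2 * \<Delta> a t d = 0" using K[of a t] by simp
    have "y1 * \<Delta> a t p' + y2 * \<Delta> a t d > 0" using Y[of a t] a(4) by simp
    then have "\<Delta> a t p' * (k2 * y1 - y2 * k1) > 0"
      using eliminate_second[OF 4, of y1 y2] k by (metis mult_pos_pos)
    then show ?thesis using 3 by (simp add: zero_less_mult_iff)
  qed
  have "\<Delta> u t w > 0" using T'(9) by (simp add: swap_right[of u t w])
  then have \<tau>u: "\<Delta> u t p' > 0" using \<tau>[of u] T' c2 by simp
  \<comment> \<open>The mirror image exchanges \<open>u\<close> and \<open>w\<close>; there this
    sign becomes the fact \<open>\<tau>r\<close> of \<open>opposite_long_edges_aux\<close>.\<close>
  have "\<Delta> w t u < 0" using T'(9) rotate[of u w t] by simp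
  then have \<tau>w: "\<Delta> w t p' > 0" using \<tau>[of w] T' c1 by (simp add: mult_neg_neg)
  show ?thesis
    by (rule that[OF pu pN nD nDd p'N dN A' \<Phi> fg(3,2) f1 f2 _ cy c1 c2 _ \<tau>u \<tau>w])
      (use F Y in \<open>simp_all add: add.commute\<close>)
qed

section \<open>Long edges of opposite orientations\<close>

lemma mirror_ori: "thrackle_configuration.ori (\<lambda>a b c. - \<Delta> a b c) S L a b \<longleftrightarrow> ori b a"
proof -
  interpret m: thrackle_configuration V "\<lambda>a b c. - \<Delta> a b c" S L by (rule mirror)
  show ?thesis unfolding m.ori_def ori_def using swap[of a b] L_sym by auto
qed

lemma mirror_long_triangle:
  "trimmed_configuration.long_triangle (\<lambda>a b c. - \<Delta> a b c) S L u w t \<longleftrightarrow> long_triangle w u t"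
proof -
  interpret m: trimmed_configuration V "\<lambda>a b c. - \<Delta> a b c" S L by (rule mirror_trimmed)
  show ?thesis unfolding m.long_triangle_def long_triangle_def mirror_ori by auto
qed

text \<open>In the fact names, \<epsilon> stands for the functional \<open>\<Delta> u w\<close>,
  \<Phi> for \<open>\<Delta> p' d\<close>, \<open>B\<close> for \<open>\<Delta> r r'\<close> and
  \<tau> for \<open>\<Delta> u t\<close>. The circles of \<open>p'd\<close> and \<open>rr'\<close>
  meet that of \<open>uw\<close> in \<open>(c1, c2)\<close> and \<open>(f2, f1)\<close>, and \<Phi>
  and \<open>B\<close> force these two points into opposite orders.\<close>

lemma opposite_long_edges_aux:
  assumes T: "long_triangle u w t" and p: "S\<^sup>*\<^sup>* t p" "p \<noteq> w" "ori p' p"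
    and r: "S\<^sup>*\<^sup>* t r" "r \<noteq> u" "ori r r'" and neg: "\<Delta> r r' p' < 0"
  shows False
proof -
  note T' = long_triangle_component[OF T]
  interpret m: trimmed_configuration V "\<lambda>a b c. - \<Delta> a b c" S L by (rule mirror_trimmed)
  obtain d where d: "S p' d" using short_neighbour oriD(1)[OF p(3)] by blast
  obtain d' where d': "S r' d'" using short_neighbour L_sym[OF oriD(1)[OF r(3)]] by blast
  obtain y1 y2 c1 c2 where P: "\<not> S\<^sup>*\<^sup>* t p'" "\<not> S\<^sup>*\<^sup>* t d" "\<Delta> u w p' > 0" "\<Delta> u w d < 0"
    and \<Phi>: "\<And>x. S\<^sup>*\<^sup>* t x \<Longrightarrow> (\<Delta> p' d x > 0 \<longleftrightarrow> \<Delta> u w x < 0) \<and> \<Delta> p' d x \<noteq> 0"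
    and y: "y1 > 0" "y2 > 0" "c2 > 0"
    and Y: "\<And>a b. y1 * \<Delta> a b p' + y2 * \<Delta> a b d = c1 * \<Delta> a b u + c2 * \<Delta> a b w"
    and \<tau>p: "\<Delta> u t p' > 0"
    by (rule long_partner[OF T p d]) blast
  obtain g1 g2 f1 f2 q1 q2 b1 b2 where R: "r \<noteq> w" "\<Delta> u w r < 0" "\<not> S\<^sup>*\<^sup>* t r'" "\<Delta> u w r' > 0" "\<Delta> u w d' < 0"
    and B: "\<And>x. \<lbrakk>S\<^sup>*\<^sup>* t x; x \<noteq> r\<rbrakk> \<Longrightarrow> (\<Delta> r r' x < 0 \<longleftrightarrow> \<not> \<Delta> u w x < 0) \<and> \<Delta> r r' x \<noteq> 0"
    and g: "g1 > 0" "g2 > 0" "f1 < 0" "f2 > 0"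
    and G: "\<And>a b. g1 * \<Delta> a b r + g2 * \<Delta> a b r' = f1 * \<Delta> a b w + f2 * \<Delta> a b u"
    and q: "q1 > 0" "q2 > 0" "b1 < 0" "b2 > 0"
    and Q: "\<And>a b. q1 * \<Delta> a b r' + q2 * \<Delta> a b d' = b1 * \<Delta> a b w + b2 * \<Delta> a b u"
    and \<tau>r: "\<Delta> u t r' < 0"
  proof (rule m.long_partner[of w u t r r' d'])
    show "m.long_triangle w u t" using T by (simp add: mirror_long_triangle)
    show "m.ori r' r" using r(3) by (simp add: mirror_ori)
    fix g1 g2 f1 f2 q1 q2 b1 b2
    assume *: "\<And>a b. g1 * - \<Delta> a b r + g2 * - \<Delta> a b r' = f1 * - \<Delta> a b w + f2 * - \<Delta> a b u"
      "\<And>a b. q1 * - \<Delta> a b r' + q2 * - \<Delta> a b d' = b1 * - \<Delta> a b w + b2 * - \<Delta> a b u"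
      and "r \<noteq> w" "- \<Delta> w u r < 0" "\<not> S\<^sup>*\<^sup>* t r'" "\<not> S\<^sup>*\<^sup>* t d'" "- \<Delta> w u r' > 0" "- \<Delta> w u d' < 0"
      "\<And>x. \<lbrakk>S\<^sup>*\<^sup>* t x; x \<noteq> r\<rbrakk> \<Longrightarrow> (- \<Delta> r' r x < 0 \<longleftrightarrow> \<not> - \<Delta> w u x < 0) \<and> - \<Delta> r' r x \<noteq> 0"
      "g1 > 0" "g2 > 0" "f1 < 0" "f2 > 0" "q1 > 0" "q2 > 0" "b1 < 0" "b2 > 0" "- \<Delta> u t r' > 0"
    moreover have "g1 * \<Delta> a b r + g2 * \<Delta> a b r' = f1 * \<Delta> a b w + f2 * \<Delta> a b u"
      "q1 * \<Delta> a b r' + q2 * \<Delta> a b d' = b1 * \<Delta> a b w + b2 * \<Delta> a b u" for a b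
      using *(1)[of a b] *(2)[of a b] by linarith+
    ultimately show thesis
      by (intro that[of g1 g2 f1 f2 q1 q2 b1 b2]) (simp_all add: swap[of w u] swap[of r' r])
  qed (use r d' in auto)
  have Lr: "L r r'" using oriD r(3) by blast
  have Bd': "\<Delta> r r' d' < 0" using oriD(3)[OF r(3) d'] .
  have p'r': "p' \<noteq> r'"
  proof
    assume e: "p' = r'"
    then have "p = r" using oriD(1)[OF p(3)] Lr L_unique2 L_sym by blast
    then show False using e p(3) r(3) ori_asym by blast
  qed
  have disj: "{r, r'} \<inter> {p', d} = {}" using P R r(1) p'r' by auto
  have Bd: "\<Delta> r r' d > 0"
    using short_edge_separates(2)[of r r' p' d] Lr d disj neg by (simp add: adj_def)
  have "{p', d} \<inter> {r', d'} = {}" using p'r' P R Bd Bd' by auto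
  then obtain v1 v2 v3 v4 where v: "v1 > 0" "v2 > 0" "v3 > 0" "v4 > 0"
    and W: "\<And>a b. v1 * \<Delta> a b p' + v2 * \<Delta> a b d = v3 * \<Delta> a b r' + v4 * \<Delta> a b d'"
    using cross_SS[OF d d'] by metis
  have \<tau>w: "\<Delta> u t w > 0" using T'(9) by (simp add: swap_right[of u t w])
  have \<epsilon>y: "y1 * \<Delta> u w p' + y2 * \<Delta> u w d = 0" using Y[of u w] by simp
  have \<epsilon>q: "q1 * \<Delta> u w r' + q2 * \<Delta> u w d' = 0" using Q[of u w] by simp
  \<comment> \<open>On the nonnegative side of \<open>uw\<close>, the circle of \<open>ut\<close>
    separates the pieces of \<open>p'd\<close> and \<open>r'd'\<close>, by \<open>\<tau>p\<close>,
    \<open>\<tau>r\<close> and the points of \<open>Y\<close> and \<open>Q\<close>. So these edges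
    cross on the negative side.\<close>
  have \<epsilon>v: "v1 * \<Delta> u w p' + v2 * \<Delta> u w d < 0"
  proof (rule ccontr)
    assume n: "\<not> ?thesis"
    have "\<Delta> u w p' * (y2 * v1 - v2 * y1) \<ge> 0"
      using eliminate_second[OF \<epsilon>y, of v1 v2] n y by (metis mult_nonneg_nonneg less_imp_le not_less)
    then have i: "y2 * v1 - v2 * y1 \<ge> 0" using P(3) by (simp add: zero_le_mult_iff)
    have "\<Delta> u w r' * (q2 * v3 - v4 * q1) \<ge> 0"
      using eliminate_second[OF \<epsilon>q, of v3 v4] n q W[of u w] by (metis mult_nonneg_nonneg less_imp_le not_less)
    then have ii: "q2 * v3 - v4 * q1 \<ge> 0" using R by (simp add: zero_le_mult_iff)
    have "y1 * \<Delta> u t p' + y2 * \<Delta> u t d > 0" using Y[of u t] y \<tau>w by simp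
    then have "v2 * (y1 * \<Delta> u t p' + y2 * \<Delta> u t d) + \<Delta> u t p' * (y2 * v1 - v2 * y1) > 0"
      using v i \<tau>p by (simp add: add_pos_nonneg)
    then have "y2 * (v1 * \<Delta> u t p' + v2 * \<Delta> u t d) > 0" by (simp add: algebra_simps)
    then have 1: "v1 * \<Delta> u t p' + v2 * \<Delta> u t d > 0" using y by (simp add: zero_less_mult_iff)
    have "q1 * \<Delta> u t r' + q2 * \<Delta> u t d' < 0" using Q[of u t] q \<tau>w by (simp add: mult_neg_pos)
    then have "v4 * (q1 * \<Delta> u t r' + q2 * \<Delta> u t d') < 0" using v by (simp add: mult_pos_neg)
    moreover have "\<Delta> u t r' * (q2 * v3 - v4 * q1) \<le> 0" using ii \<tau>r by (simp add: mult_nonpos_nonneg)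
    ultimately have "v4 * (q1 * \<Delta> u t r' + q2 * \<Delta> u t d') + \<Delta> u t r' * (q2 * v3 - v4 * q1) < 0" by linarith
    then have "q2 * (v3 * \<Delta> u t r' + v4 * \<Delta> u t d') < 0" by (simp add: algebra_simps)
    then have "v3 * \<Delta> u t r' + v4 * \<Delta> u t d' < 0" using q by (simp add: mult_less_0_iff)
    then show False using 1 W[of u t] by simp
  qed
  \<comment> \<open>From \<open>p'\<close> to \<open>d\<close>, the circle of \<open>uw\<close> is
    met before \<open>r'd'\<close>. \<open>B\<close> is negative at \<open>p'\<close> and at the
    crossing with \<open>r'd'\<close>, hence also in between.\<close>
  have By: "y1 * \<Delta> r r' p' + y2 * \<Delta> r r' d < 0"
  proof -
    have "\<Delta> u w p' * (y2 * v1 - v2 * y1) < 0"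
      using eliminate_second[OF \<epsilon>y, of v1 v2] \<epsilon>v y by (metis mult_pos_neg)
    then have "v2 * y1 - y2 * v1 > 0" using P(3) by (simp add: mult_less_0_iff)
    then have "\<Delta> r r' p' * (v2 * y1 - y2 * v1) < 0" using neg by (simp add: mult_neg_pos)
    moreover have "v1 * \<Delta> r r' p' + v2 * \<Delta> r r' d < 0" using W[of r r'] v Bd' by (simp add: mult_pos_neg)
    then have "y2 * (v1 * \<Delta> r r' p' + v2 * \<Delta> r r' d) < 0" using y by (simp add: mult_pos_neg)
    ultimately have "v2 * (y1 * \<Delta> r r' p' + y2 * \<Delta> r r' d) < 0" by (simp add: algebra_simps)
    then show ?thesis using v by (simp add: mult_less_0_iff)
  qed
  obtain e1 e2 z1 z2 where e: "e1 < 0 \<or> e2 < 0" "z1 > 0" "z2 > 0"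
    and Z: "\<And>a b. e1 * \<Delta> a b r + e2 * \<Delta> a b r' = z1 * \<Delta> a b p' + z2 * \<Delta> a b d"
    using cross_LS[OF Lr d disj] by metis
  \<comment> \<open>\<open>B\<close> vanishes where \<open>p'd\<close> crosses \<open>rr'\<close>,
    so this point comes after the circle of \<open>uw\<close>, on its negative side. This tells
    which coefficient of the long edge \<open>rr'\<close> is negative.\<close>
  have Bz: "z1 * \<Delta> r r' p' + z2 * \<Delta> r r' d = 0" using Z[of r r'] by simp
  have "\<Delta> r r' p' * (z2 * y1 - y2 * z1) < 0"
    using eliminate_second[OF Bz, of y1 y2] By e by (metis mult_pos_neg)
  then have "y2 * z1 - z2 * y1 < 0" using neg by (simp add: mult_less_0_iff)
  then have "y2 * (z1 * \<Delta> u w p' + z2 * \<Delta> u w d) < 0"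
    using eliminate_second[OF \<epsilon>y, of z1 z2] P(3) by (simp add: mult_pos_neg)
  then have \<epsilon>z: "e1 * \<Delta> u w r + e2 * \<Delta> u w r' < 0" using Z[of u w] y by (simp add: mult_less_0_iff)
  have e2: "e2 < 0"
  proof (rule ccontr)
    assume "\<not> e2 < 0"
    then have "e2 * \<Delta> u w r' \<ge> 0" "e1 < 0" using R e by auto
    moreover have "e1 * \<Delta> u w r > 0" using \<open>e1 < 0\<close> R by (simp add: mult_neg_neg)
    ultimately show False using \<epsilon>z by linarith
  qed
  \<comment> \<open>Comparing this crossing point with the point of \<open>G\<close> on the circle
    of \<open>rr'\<close> gives the sign of \<Phi> at the latter.\<close>
  have \<Phi>z: "e1 * \<Delta> p' d r + e2 * \<Delta> p' d r' = 0" using Z[of p' d] by simp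
  have \<epsilon>g: "g1 * \<Delta> u w r + g2 * \<Delta> u w r' = 0" using G[of u w] by simp
  have "\<Delta> u w r * (g2 * e1 - e2 * g1) < 0"
    using eliminate_second[OF \<epsilon>g, of e1 e2] \<epsilon>z g by (metis mult_pos_neg)
  then have "g2 * e1 - e2 * g1 > 0" using R by (simp add: mult_less_0_iff)
  then have "e2 * (g1 * \<Delta> p' d r + g2 * \<Delta> p' d r') < 0"
    using eliminate_second[OF \<Phi>z, of g1 g2] \<Phi>[OF r(1)] R by (simp add: mult_pos_neg)
  then have \<Phi>b: "f2 * \<Delta> p' d u + f1 * \<Delta> p' d w > 0" using G[of p' d] e2 by (simp add: mult_less_0_iff)
  have \<Phi>y: "c1 * \<Delta> p' d u + c2 * \<Delta> p' d w = 0" using Y[of p' d] by simp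
  have Bb: "f2 * \<Delta> r r' u + f1 * \<Delta> r r' w = 0" using G[of r r'] by simp
  have By': "c1 * \<Delta> r r' u + c2 * \<Delta> r r' w < 0" using Y[of r r'] By by simp
  have \<Phi>u: "\<Delta> p' d u < 0" using \<Phi>[OF T'(2)] by simp
  have Bu: "\<Delta> r r' u < 0" using B[OF T'(2)] r by simp
  have "\<Delta> p' d u * (c2 * f2 - f1 * c1) > 0"
    using eliminate_second[OF \<Phi>y, of f2 f1] \<Phi>b y by (metis mult_pos_pos)
  then have 1: "c2 * f2 - f1 * c1 < 0" using \<Phi>u by (simp add: zero_less_mult_iff)
  have "\<Delta> r r' u * (f1 * c1 - c2 * f2) > 0"
    using eliminate_second[OF Bb, of c1 c2] By' g by (metis mult_neg_neg)
  then have "f1 * c1 - c2 * f2 < 0" using Bu by (simp add: zero_less_mult_iff)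
  then show False using 1 by simp
qed

lemma opposite_long_edges:
  assumes T: "long_triangle u w t" and p: "S\<^sup>*\<^sup>* t p" "p \<noteq> w" "ori p' p"
    and r: "S\<^sup>*\<^sup>* t r" "r \<noteq> u" "ori r r'"
  shows False
proof -
  note T' = long_triangle_component[OF T]
  interpret m: trimmed_configuration V "\<lambda>a b c. - \<Delta> a b c" S L by (rule mirror_trimmed)
  obtain d where d: "S p' d" using short_neighbour oriD(1)[OF p(3)] by blast
  have Lp: "L p' p" "L p p'" and Lr: "L r r'" using oriD p(3) r(3) L_sym by blast+
  have pN: "\<Delta> u w p < 0" "\<not> S\<^sup>*\<^sup>* t p'"
    and A: "\<And>x. \<lbrakk>S\<^sup>*\<^sup>* t x; x \<noteq> p\<rbrakk> \<Longrightarrow> (\<Delta> p' p x < 0 \<longleftrightarrow> \<not> \<Delta> u w x < 0) \<and> \<Delta> p' p x \<noteq> 0"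
    by (rule long_partner[OF T p d]; blast)+
  have rw: "r \<noteq> w"
  proof
    assume "r = w"
    then show False using Lr T' L_unique L_sym r(3) ori_asym by metis
  qed
  have rN: "\<Delta> u w r < 0" using long_endpoint_side[OF T r(1,2) rw Lr] .
  have pr: "p \<noteq> r"
  proof
    assume "p = r"
    then show False using Lr Lp L_unique p(3) r(3) ori_asym by metis
  qed
  have "p' \<noteq> r" using pN r by blast
  then have disj: "{p', p} \<inter> {r, r'} = {}" "p' \<noteq> r'"
    using L_disjoint[OF Lp(2) Lr] pr Lp Lr L_unique L_sym by blast+
  have Ar: "\<Delta> p' p r > 0" using A[OF r(1)] pr rN by force
  have "(\<Delta> u w r < 0 \<longleftrightarrow> \<Delta> r r' r < 0) \<longleftrightarrow> (\<Delta> u w p < 0 \<longleftrightarrow> \<Delta> r r' p < 0)"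
    using component_ori[OF r(1) p(1) T'(6) r(3)] .
  then have "\<not> \<Delta> r r' p < 0" using rN pN by simp
  then have Bp: "\<Delta> r r' p > 0" using ori_nonzero[OF r(3) L_in[OF Lp(2)]] disj by fastforce
  have "\<Delta> r r' p' \<noteq> 0" using ori_nonzero[OF r(3) L_in[OF Lp(1)]] disj by blast
  then consider "\<Delta> r r' p' < 0" | "\<Delta> r r' p' > 0" by linarith
  then show False
  proof cases
    case 1
    then show False using opposite_long_edges_aux[OF T p r] by blast
  next
    case 2
    \<comment> \<open>\<open>p'\<close> and \<open>p\<close> lie on one side of \<open>rr'\<close>,
      so \<open>r\<close> and \<open>r'\<close> lie on different sides of \<open>p'p\<close>. This
      is the hypothesis of the previous lemma in the mirror image, with the two long edges
      exchanged.\<close>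
    then have "\<Delta> p' p r' < 0" using cross_LL_other_side(1)[OF Lp(1) Lr disj(1)] Bp Ar by simp
    then show False
      using m.opposite_long_edges_aux[of w u t r r' p p'] T p r swap[of p' p]
      by (simp add: mirror_long_triangle mirror_ori)
  qed
qed

theorem edges_le_vertices: "card edges \<le> card V"
proof (rule ccontr)
  assume "\<not> ?thesis"
  then have c: "card V < card edges" by simp
  interpret m: trimmed_configuration V "\<lambda>a b c. - \<Delta> a b c" S L by (rule mirror_trimmed)
  obtain u w t f where 1: "long_triangle u w t" "\<And>v. v \<in> V \<Longrightarrow> leftmost v (f v)" "\<And>v. v \<in> V \<Longrightarrow> f (f v) \<noteq> v"
    using excess_marking[OF c] by blast
  obtain u' w' t' f' where 2: "m.long_triangle w' u' t'" "\<And>v. v \<in> V \<Longrightarrow> m.leftmost v (f' v)" "\<And>v. v \<in> V \<Longrightarrow> f' (f' v) \<noteq> v"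
    using m.excess_marking[OF c] by blast
  have T': "long_triangle u' w' t'" using 2(1) by (simp add: mirror_long_triangle)
  then have eq: "w' = w" "t' = t" using long_triangle_unique[OF 1(1)] by auto
  then have "u' = u" using 1(1) T' L_unique2 unfolding long_triangle_def by (metis oriD(1))
  obtain p p' where p: "S\<^sup>*\<^sup>* t p" "p \<noteq> w" "ori p' p" using cycle_meets_long_edge[OF 1] by blast
  obtain r r' where r: "S\<^sup>*\<^sup>* t' r" "r \<noteq> u'" "m.ori r' r" using m.cycle_meets_long_edge[OF 2] by blast
  then show False using opposite_long_edges[OF 1(1) p, of r r'] eq \<open>u' = u\<close> by (simp add: mirror_ori)
qed

end

section \<open>Removal of vertices with at most one neighbour\<close>

lemma thrackle_configuration_edges_le_vertices:
  "thrackle_configuration V \<Delta> S L \<Longrightarrow> card (thrackle_configuration.edges S L) \<le> card V"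
proof (induction "card V" arbitrary: V S L rule: less_induct)
  case less
  interpret thrackle_configuration V \<Delta> S L by (rule less.prems)
  show ?case
  proof (cases "\<forall>v\<in>V. \<exists>a b. a \<noteq> b \<and> adj v a \<and> adj v b")
    case True
    then interpret trimmed_configuration V \<Delta> S L by unfold_locales blast
    show ?thesis by (rule edges_le_vertices)
  next
    case False
    then obtain v where v: "v \<in> V" "\<And>a b. adj v a \<Longrightarrow> adj v b \<Longrightarrow> a = b" by blast
    define S' L' where "S' a b \<longleftrightarrow> S a b \<and> a \<noteq> v \<and> b \<noteq> v" and "L' a b \<longleftrightarrow> L a b \<and> a \<noteq> v \<and> b \<noteq> v" for a b
    have c: "thrackle_configuration (V - {v}) \<Delta> S' L'"
    proof (unfold_locales, unfold S'_def L'_def, goal_cases)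
      case 1 then show ?case by (simp add: finite_V)
    next
      case 2 then show ?case by (rule rotate)
    next
      case 3 then show ?case by (rule swap)
    next
      case 4 then show ?case by (simp add: general_position)
    next
      case 5 then show ?case by (simp add: S_sym)
    next
      case 6 then show ?case by (simp add: L_sym)
    next
      case 7 then show ?case by (auto intro: S_in)
    next
      case 8 then show ?case by (auto intro: L_in)
    next
      case 9 then show ?case by (simp add: S_irrefl)
    next
      case 10 then show ?case by (simp add: L_irrefl)
    next
      case 11 then show ?case by (blast dest: not_S_L)
    next
      case 12 then show ?case by (blast dest: L_unique)
    next
      case 13 then show ?case by (intro cross_SS) auto
    next
      case 14 then show ?case by (intro cross_LS) auto
    next
      case 15 then show ?case by (intro cross_LL) auto
    qed
    interpret r: thrackle_configuration "V - {v}" \<Delta> S' L' by (rule c)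
    have cV: "card V = Suc (card (V - {v}))" using card.remove[OF finite_V v(1)] .
    have IH: "card r.edges \<le> card (V - {v})" using less.hyps[OF _ c] cV by simp
    \<comment> \<open>For an isolated \<open>v\<close> any \<open>x\<close> will do.\<close>
    obtain x where "\<And>a. adj v a \<Longrightarrow> a = x" using v(2) by blast
    then have "edges \<subseteq> insert {v, x} r.edges"
      unfolding edges_def r.edges_def r.adj_def S'_def L'_def using adj_sym unfolding adj_def by fast
    then have "card edges \<le> card (insert {v, x} r.edges)" using r.finite_edges by (simp add: card_mono)
    also have "\<dots> \<le> Suc (card r.edges)" using r.finite_edges by (simp add: card_insert_if)
    finally show ?thesis using IH cV by simp
  qed
qed

section \<open>Perturbation to general position\<close>

definition triple :: "real^3 \<Rightarrow> real^3 \<Rightarrow> real^3 \<Rightarrow> real" where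
  "triple a b c = a \<bullet> cross3 b c"

lemma triple_rotate: "triple a b c = triple b c a"
  by (simp add: triple_def cross3_simps)

lemma triple_swap: "triple b a c = - triple a b c"
  by (simp add: triple_def cross3_simps)

lemma triple_add: "triple x y (c + d) = triple x y c + triple x y d"
  by (simp add: triple_def cross3_simps)

lemma triple_scaleR: "triple x y (r *\<^sub>R c) = r * triple x y c"
  by (simp add: triple_def cross3_simps)

text \<open>Cramer's rule for the linear relation between four vectors of three-space; all crossing
  coefficients come from it.\<close>

lemma triple_dependency:
  "triple b c d *\<^sub>R a + (- triple a c d) *\<^sub>R b = (- triple a b d) *\<^sub>R c + triple a b c *\<^sub>R d"
  unfolding triple_def vec_eq_iff forall_3 by (simp add: cross3_simps)

lemma tendsto_cross3:
  assumes "(f \<longlongrightarrow> a) F" "(g \<longlongrightarrow> b) F"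
  shows "((\<lambda>s. cross3 (f s) (g s)) \<longlongrightarrow> cross3 a b) F"
proof -
  have *: "((\<lambda>s. f s $ i) \<longlongrightarrow> a $ i) F" "((\<lambda>s. g s $ i) \<longlongrightarrow> b $ i) F" for i
    using assms by (auto intro: tendsto_intros)
  have "((\<lambda>s. cross3 (f s) (g s) $ i) \<longlongrightarrow> cross3 a b $ i) F" for i
    using exhaust_3[of i]
    by (elim disjE; simp only: cross_components; intro tendsto_diff tendsto_mult *)
  then show ?thesis by (rule vec_tendstoI)
qed

lemma tendsto_triple:
  assumes "(f \<longlongrightarrow> a) F" "(g \<longlongrightarrow> b) F" "(h \<longlongrightarrow> c) F"
  shows "((\<lambda>s. triple (f s) (g s) (h s)) \<longlongrightarrow> triple a b c) F"
  unfolding triple_def by (intro tendsto_intros tendsto_cross3 assms)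

text \<open>The direction \<open>w\<close> treats the edges of length \<open>pi\<close>, and
  \<open>q\<close> provides general position. The latter is of second order so that it cannot undo
  the effect of the former.\<close>

definition perturb :: "real^3 \<Rightarrow> real^3 \<Rightarrow> real^3 \<Rightarrow> real \<Rightarrow> real^3" where
  "perturb p w q s = p + s *\<^sub>R w + s\<^sup>2 *\<^sub>R q"

lemma perturb_tendsto: "(perturb p w q \<longlongrightarrow> p) (at_right 0)"
proof -
  have "((\<lambda>s. p + s *\<^sub>R w + s\<^sup>2 *\<^sub>R q) \<longlongrightarrow> p + 0 *\<^sub>R w + 0\<^sup>2 *\<^sub>R q) (at_right 0)"
    by (intro tendsto_intros)
  then show ?thesis by (simp add: perturb_def[abs_def])
qed

text \<open>The moment curve: its points at distinct parameters have a nonzero Vandermonde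
  determinant.\<close>

definition moment :: "real \<Rightarrow> real^3" where "moment x = vector [1, x, x\<^sup>2]"

lemma triple_moment: "triple (moment x) (moment y) (moment z) = (y - x) * (z - x) * (z - y)"
  by (simp add: triple_def moment_def cross3_simps power2_eq_square)

lemma poly_eventually_nonzero:
  fixes F :: "real poly"
  assumes "F \<noteq> 0"
  shows "eventually (\<lambda>s. poly F s \<noteq> 0) (at_right a)"
proof -
  obtain e where e: "e > 0" "\<And>x. poly F x = 0 \<Longrightarrow> x \<noteq> a \<Longrightarrow> e \<le> dist a x"
    using finite_set_avoid[OF poly_roots_finite[OF assms]] by (metis mem_Collect_eq)
  have "eventually (\<lambda>s. s \<in> {a<..<a + e}) (at_right a)"
    using e by (intro eventually_at_right_real) simp
  then show ?thesis
    by (rule eventually_mono) (use e(2) in \<open>force simp: dist_real_def\<close>)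
qed

text \<open>The determinant is a polynomial in \<open>s\<close> whose leading coefficient is the determinant of the
  \<open>q\<close>'s.\<close>

lemma perturb_general_position:
  assumes "triple q1 q2 q3 \<noteq> 0"
  shows "eventually (\<lambda>s. triple (perturb p1 w1 q1 s) (perturb p2 w2 q2 s) (perturb p3 w3 q3 s) \<noteq> 0) (at_right 0)"
proof -
  define c where "c p w q i = [:p $ i, w $ i, q $ i:]" for p w q :: "real^3" and i
  have c: "poly (c p w q i) s = perturb p w q s $ i" for p w q i s
    by (simp add: c_def perturb_def power2_eq_square algebra_simps)
  define F where "F =
    c p1 w1 q1 1 * (c p2 w2 q2 2 * c p3 w3 q3 3 - c p3 w3 q3 2 * c p2 w2 q2 3) +
    c p1 w1 q1 2 * (c p2 w2 q2 3 * c p3 w3 q3 1 - c p3 w3 q3 3 * c p2 w2 q2 1) +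
    c p1 w1 q1 3 * (c p2 w2 q2 1 * c p3 w3 q3 2 - c p3 w3 q3 1 * c p2 w2 q2 2)"
  have F: "poly F s = triple (perturb p1 w1 q1 s) (perturb p2 w2 q2 s) (perturb p3 w3 q3 s)" for s
    by (simp add: F_def c triple_def inner_vec_def sum_3 cross_components)
  have "F \<noteq> 0"
  proof
    assume "F = 0"
    then have 0: "triple (perturb p1 w1 q1 s) (perturb p2 w2 q2 s) (perturb p3 w3 q3 s) = 0" for s
      using F[of s] by simp
    \<comment> \<open>Replacing \<open>s\<close> by \<open>1 / s\<close> reverses the coefficients,
      so the leading coefficient becomes the value of a limit at zero.\<close>
    have rev: "perturb q w p s = s\<^sup>2 *\<^sub>R perturb p w q (1 / s)" if "s \<noteq> 0" for p w q s
      using that by (simp add: perturb_def algebra_simps power2_eq_square)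
    have z: "triple (perturb q1 w1 p1 s) (perturb q2 w2 p2 s) (perturb q3 w3 p3 s) = 0" if "s > 0" for s
      using that 0[of "1 / s"]
      by (simp add: rev[of s q1 w1 p1] rev[of s q2 w2 p2] rev[of s q3 w3 p3]
          triple_def cross_mult_left cross_mult_right)
    have "((\<lambda>s. triple (perturb q1 w1 p1 s) (perturb q2 w2 p2 s) (perturb q3 w3 p3 s)) \<longlongrightarrow> triple q1 q2 q3) (at_right 0)"
      by (intro tendsto_triple perturb_tendsto)
    moreover have "eventually (\<lambda>s::real. triple (perturb q1 w1 p1 s) (perturb q2 w2 p2 s) (perturb q3 w3 p3 s) = 0) (at_right 0)"
      using eventually_at_right_less[of "0::real"] by (rule eventually_mono) (rule z)
    ultimately have "((\<lambda>s::real. 0) \<longlongrightarrow> triple q1 q2 q3) (at_right (0::real))"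
      using tendsto_cong by fastforce
    then have "triple q1 q2 q3 = 0" using tendsto_unique[OF _ _ tendsto_const[of 0 "at_right (0::real)"]] by fastforce
    then show False using assms by simp
  qed
  from poly_eventually_nonzero[OF this, of 0] show ?thesis by (simp add: F)
qed

section \<open>Great circles\<close>

definition circle_point :: "real^3 \<Rightarrow> real^3 \<Rightarrow> real \<Rightarrow> real^3" where
  "circle_point a t \<theta> = cos \<theta> *\<^sub>R a + sin \<theta> *\<^sub>R t"

definition frame :: "real^3 \<Rightarrow> real^3 \<Rightarrow> bool" where
  "frame a t \<longleftrightarrow> norm a = 1 \<and> norm t = 1 \<and> a \<bullet> t = 0"

lemma circle_point_0 [simp]: "circle_point a t 0 = a"
  and circle_point_pi [simp]: "circle_point a t pi = - a"
  by (simp_all add: circle_point_def)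

lemma frame_inner:
  assumes "frame a t"
  shows "a \<bullet> a = 1" "t \<bullet> t = 1" "a \<bullet> t = 0" "t \<bullet> a = 0"
  using assms by (auto simp: frame_def norm_eq_1 inner_commute)

lemma inner_circle_points:
  assumes "frame a t"
  shows "circle_point a t \<theta> \<bullet> circle_point a t \<phi> = cos (\<theta> - \<phi>)"
  using frame_inner[OF assms] by (simp add: circle_point_def inner_add_left inner_add_right cos_diff)

text \<open>\<open>circle_point t (- a) \<theta>\<close> is the unit tangent vector at angle \<open>\<theta>\<close>.\<close>

lemma circle_point_shift:
  "circle_point a t \<phi> = circle_point (circle_point a t \<theta>) (circle_point t (- a) \<theta>) (\<phi> - \<theta>)"
proof -
  have "cos \<phi> = cos ((\<phi> - \<theta>) + \<theta>)" "sin \<phi> = sin ((\<phi> - \<theta>) + \<theta>)" by simp_all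
  then have c: "cos \<phi> = cos (\<phi> - \<theta>) * cos \<theta> - sin (\<phi> - \<theta>) * sin \<theta>"
    and s: "sin \<phi> = sin (\<phi> - \<theta>) * cos \<theta> + cos (\<phi> - \<theta>) * sin \<theta>"
    unfolding cos_add sin_add by simp_all
  show ?thesis unfolding circle_point_def c s by (simp add: algebra_simps)
qed

lemma frame_shift:
  assumes "frame a t"
  shows "frame (circle_point a t \<theta>) (circle_point t (- a) \<theta>)"
    "cross3 (circle_point a t \<theta>) (circle_point t (- a) \<theta>) = cross3 a t"
proof -
  note i = frame_inner[OF assms]
  have sc: "cos \<theta> * cos \<theta> + sin \<theta> * sin \<theta> = 1"
    using sin_cos_squared_add2[of \<theta>] by (simp add: power2_eq_square)
  show "frame (circle_point a t \<theta>) (circle_point t (- a) \<theta>)"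
    using i sc by (simp add: frame_def norm_eq_1 circle_point_def inner_add_left inner_add_right inner_diff_left inner_diff_right algebra_simps)
  have "cross3 (circle_point a t \<theta>) (circle_point t (- a) \<theta>) =
      (cos \<theta> * cos \<theta>) *\<^sub>R cross3 a t + (sin \<theta> * sin \<theta>) *\<^sub>R cross3 a t"
    by (simp add: circle_point_def cross_add_left cross_add_right cross_mult_left cross_mult_right
        cross_skew[of t a] Cross3.left_diff_distrib Cross3.right_diff_distrib)
  then show "cross3 (circle_point a t \<theta>) (circle_point t (- a) \<theta>) = cross3 a t"
    using sc by (simp add: scaleR_add_left[symmetric])
qed

text \<open>\<open>cross3 t t'\<close> has zero inner and cross product with the unit vector
  \<open>x\<close>, so it vanishes, and parallel unit vectors agree up to sign.\<close>

lemma coplanar_tangents: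
  assumes "frame x t" "frame x t'" "cross3 x t' \<bullet> t = 0"
  shows "t = t' \<or> t = - t'"
proof -
  note i = frame_inner[OF assms(1)] and i' = frame_inner[OF assms(2)]
  have "x \<bullet> cross3 t t' = 0" using assms(3) by (simp add: cross3_simps)
  moreover have "cross3 x (cross3 t t') = (x \<bullet> t') *\<^sub>R t - (x \<bullet> t) *\<^sub>R t'"
    unfolding vec_eq_iff forall_3 by (simp add: cross3_simps)
  then have "cross3 x (cross3 t t') = 0" using i i' by simp
  ultimately have "cross3 t t' = 0" using norm_and_cross_eq_0[of x "cross3 t t'"] i by auto
  then have "(t \<bullet> t')\<^sup>2 = 1" using norm_cross_dot[of t t'] assms by (simp add: frame_def)
  then have "t \<bullet> t' = 1 \<or> t \<bullet> t' = -1" by (simp add: power2_eq_1_iff)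
  then have "(t - t') \<bullet> (t - t') = 0 \<or> (t + t') \<bullet> (t + t') = 0"
    using i i' by (simp add: inner_add_left inner_add_right inner_diff_left inner_diff_right inner_commute[of t' t]) linarith
  then show ?thesis by (simp add: add_eq_0_iff2)
qed

text \<open>Dividing by the positive \<kappa> copes with a normal vector \<open>Y\<close> that may
  tend to zero. The factor \<open>g\<close> occurs twice in the limit, so its square makes the limit
  positive.\<close>

lemma eventually_sign:
  fixes X Y :: "real \<Rightarrow> real^3"
  assumes "(X \<longlongrightarrow> x) (at_right 0)" "((\<lambda>s. (1 / \<kappa> s) *\<^sub>R Y s) \<longlongrightarrow> g *\<^sub>R n) (at_right 0)"
    and "\<And>s. s > 0 \<Longrightarrow> \<kappa> s > 0" "g \<noteq> 0" "k * (x \<bullet> n) > 0"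
  shows "eventually (\<lambda>s. 0 < g * (k * (X s \<bullet> Y s))) (at_right 0)"
proof -
  have "((\<lambda>s. g * (k * (X s \<bullet> ((1 / \<kappa> s) *\<^sub>R Y s)))) \<longlongrightarrow> g * (k * (x \<bullet> (g *\<^sub>R n)))) (at_right 0)"
    by (intro tendsto_intros assms)
  moreover have "g * (k * (x \<bullet> (g *\<^sub>R n))) = g * g * (k * (x \<bullet> n))" by simp
  moreover have "g * g * (k * (x \<bullet> n)) > 0" 
    using assms(4,5) by (metis mult_pos_pos not_real_square_gt_zero)
  ultimately have "eventually (\<lambda>s. 0 < g * (k * (X s \<bullet> ((1 / \<kappa> s) *\<^sub>R Y s)))) (at_right 0)"
    by (metis order_tendstoD(1))
  moreover have "eventually (\<lambda>s::real. s > 0) (at_right 0)" by (rule eventually_at_right_less)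
  ultimately show ?thesis
  proof eventually_elim
    case (elim s)
    have "g * (k * (X s \<bullet> Y s)) = \<kappa> s * (g * (k * (X s \<bullet> ((1 / \<kappa> s) *\<^sub>R Y s))))"
      using assms(3)[OF elim(2)] by simp
    then show ?case using elim assms(3)[OF elim(2)] by (metis mult_pos_pos)
  qed
qed

text \<open>By Cramer's rule each coefficient pairs an end of one arc with the normal vector of the
  other. The point of the first arc at angle \<psi> has signed distance
  \<open>k * sin (\<psi> - \<theta>)\<close> from the plane of the second, and similarly with
  \<open>- k\<close>; scaling by \<open>sgn k\<close> leaves the sines and the factors
  \<open>g\<close>, \<open>g'\<close> of the limiting normals.\<close>

lemma crossing_coefficient_signs:
  fixes A B C D :: "real \<Rightarrow> real^3"
  assumes fr: "frame a t" "frame c t'" and x: "circle_point a t \<theta> = circle_point c t' \<phi>"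
    and K: "cross3 c t' \<bullet> circle_point t (- a) \<theta> \<noteq> 0"
    and lim: "(A \<longlongrightarrow> a) (at_right 0)" "(B \<longlongrightarrow> circle_point a t M) (at_right 0)"
      "(C \<longlongrightarrow> c) (at_right 0)" "(D \<longlongrightarrow> circle_point c t' N) (at_right 0)"
    and crl: "((\<lambda>s. (1 / \<kappa> s) *\<^sub>R cross3 (A s) (B s)) \<longlongrightarrow> g *\<^sub>R cross3 a t) (at_right 0)"
      "((\<lambda>s. (1 / \<kappa>' s) *\<^sub>R cross3 (C s) (D s)) \<longlongrightarrow> g' *\<^sub>R cross3 c t') (at_right 0)"
    and pos: "\<And>s. s > 0 \<Longrightarrow> \<kappa> s > 0" "\<And>s. s > 0 \<Longrightarrow> \<kappa>' s > 0" and g: "g \<noteq> 0" "g' \<noteq> 0"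
  shows "eventually (\<lambda>s. \<exists>\<alpha> \<beta> \<gamma> \<delta>. \<alpha> *\<^sub>R A s + \<beta> *\<^sub>R B s = \<gamma> *\<^sub>R C s + \<delta> *\<^sub>R D s \<and>
      (0 < sin (M - \<theta>) \<longrightarrow> 0 < g' * \<alpha>) \<and> (0 < sin \<theta> \<longrightarrow> 0 < g' * \<beta>) \<and>
      (0 < sin (N - \<phi>) \<longrightarrow> 0 < g * \<gamma>) \<and> (0 < sin \<phi> \<longrightarrow> 0 < g * \<delta>)) (at_right 0)"
proof -
  define X T T' k where "X = circle_point a t \<theta>" and "T = circle_point t (- a) \<theta>"
    and "T' = circle_point t' (- c) \<phi>" and "k = cross3 c t' \<bullet> T"
  have e: "circle_point a t \<psi> = circle_point X T (\<psi> - \<theta>)" for \<psi>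
    unfolding X_def T_def by (rule circle_point_shift)
  have f: "circle_point c t' \<psi> = circle_point X T' (\<psi> - \<phi>)" for \<psi>
    unfolding X_def x T'_def by (rule circle_point_shift)
  have n: "cross3 a t = cross3 X T" "cross3 c t' = cross3 X T'"
    using frame_shift(2)[OF fr(1), of \<theta>] frame_shift(2)[OF fr(2), of \<phi>] by (auto simp: X_def T_def T'_def x)
  have kT: "T \<bullet> cross3 X T' = k" "T' \<bullet> cross3 X T = - k"
    using n by (auto simp: k_def cross3_simps)
  have 1: "circle_point a t \<psi> \<bullet> cross3 c t' = k * sin (\<psi> - \<theta>)" for \<psi>
    unfolding e n by (simp add: circle_point_def inner_add_left dot_cross_self kT)
  have 2: "circle_point c t' \<psi> \<bullet> cross3 a t = - k * sin (\<psi> - \<phi>)" for \<psi>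
    unfolding f n by (simp add: circle_point_def inner_add_left dot_cross_self kT)
  have k0: "k \<noteq> 0" using K by (simp add: k_def T_def)
  have k: "sgn k * (k * z) > 0" if "z > 0" for z 
    using k0 that by (simp add: sgn_if mult_neg_pos)
  have ev\<alpha>: "eventually (\<lambda>s. 0 < sin (M - \<theta>) \<longrightarrow> 0 < g' * (sgn k * (B s \<bullet> cross3 (C s) (D s)))) (at_right 0)"
  proof (cases "0 < sin (M - \<theta>)")
    case True
    then show ?thesis using eventually_sign[OF lim(2) crl(2) pos(2) g(2), of "sgn k"] k 1[of M] by simp
  qed simp
  have ev\<beta>: "eventually (\<lambda>s. 0 < sin \<theta> \<longrightarrow> 0 < g' * (- sgn k * (A s \<bullet> cross3 (C s) (D s)))) (at_right 0)"
  proof (cases "0 < sin \<theta>")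
    case True
    then show ?thesis using eventually_sign[OF lim(1) crl(2) pos(2) g(2), of "- sgn k"] k 1[of 0] by simp
  qed simp
  have ev\<gamma>: "eventually (\<lambda>s. 0 < sin (N - \<phi>) \<longrightarrow> 0 < g * (- sgn k * (D s \<bullet> cross3 (A s) (B s)))) (at_right 0)"
  proof (cases "0 < sin (N - \<phi>)")
    case True
    then show ?thesis using eventually_sign[OF lim(4) crl(1) pos(1) g(1), of "- sgn k"] k 2[of N] by simp
  qed simp
  have ev\<delta>: "eventually (\<lambda>s. 0 < sin \<phi> \<longrightarrow> 0 < g * (sgn k * (C s \<bullet> cross3 (A s) (B s)))) (at_right 0)"
  proof (cases "0 < sin \<phi>")
    case True
    then show ?thesis using eventually_sign[OF lim(3) crl(1) pos(1) g(1), of "sgn k"] k 2[of 0] by simp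
  qed simp
  show ?thesis
    using ev\<alpha> ev\<beta> ev\<gamma> ev\<delta>
  proof eventually_elim
    case (elim s)
    have "(sgn k * (B s \<bullet> cross3 (C s) (D s))) *\<^sub>R A s + (- sgn k * (A s \<bullet> cross3 (C s) (D s))) *\<^sub>R B s
      = (- sgn k * (D s \<bullet> cross3 (A s) (B s))) *\<^sub>R C s + (sgn k * (C s \<bullet> cross3 (A s) (B s))) *\<^sub>R D s"
    proof -
      have 3: "D s \<bullet> cross3 (A s) (B s) = triple (A s) (B s) (D s)" "C s \<bullet> cross3 (A s) (B s) = triple (A s) (B s) (C s)"
        using triple_rotate unfolding triple_def[symmetric] by metis+
      show ?thesis unfolding 3
        using arg_cong[OF triple_dependency[of "B s" "C s" "D s" "A s"], of "\<lambda>v. sgn k *\<^sub>R v"]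
        by (simp only: triple_def scaleR_add_right scaleR_scaleR mult_minus_left mult_minus_right)
    qed
    then show ?case using elim by blast
  qed
qed

text \<open>An arc of length exactly \<open>pi\<close> has antipodal ends; pushing the far end back along the arc makes
  the normal vector of the perturbed pair converge, after division by \<open>s\<close>, to that of the arc.\<close>

lemma perturbed_normal:
  assumes "l = pi \<Longrightarrow> w = 0 \<and> w' = t"
  shows "((\<lambda>s. (1 / (if l = pi then s else 1)) *\<^sub>R
      cross3 (perturb a w q s) (perturb (circle_point a t l) w' q' s)) \<longlongrightarrow>
    (if l = pi then 1 else sin l) *\<^sub>R cross3 a t) (at_right 0)"
proof (cases "l = pi")
  case True
  \<comment> \<open>The far end is minus the near end plus a multiple of \<open>s\<close>; the near
    end drops out of the cross product.\<close>
  have *: "(1 / s) *\<^sub>R cross3 (perturb a w q s) (perturb (circle_point a t l) w' q' s)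
    = cross3 (perturb a w q s) (t + s *\<^sub>R (q + q'))" if "s > 0" for s
  proof -
    have "perturb (circle_point a t l) w' q' s = - perturb a w q s + s *\<^sub>R (t + s *\<^sub>R (q + q'))"
      using assms[OF True] True by (simp add: perturb_def algebra_simps power2_eq_square)
    then show ?thesis using that by (simp add: cross_add_right cross_mult_right Cross3.right_diff_distrib)
  qed
  have "((\<lambda>s. cross3 (perturb a w q s) (t + s *\<^sub>R (q + q'))) \<longlongrightarrow> cross3 a (t + 0 *\<^sub>R (q + q'))) (at_right 0)"
    by (intro tendsto_cross3 perturb_tendsto tendsto_intros)
  moreover have "eventually (\<lambda>s. cross3 (perturb a w q s) (t + s *\<^sub>R (q + q')) =
    (1 / s) *\<^sub>R cross3 (perturb a w q s) (perturb (circle_point a t l) w' q' s)) (at_right 0)"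
    using eventually_at_right_less[of "0::real"] by (rule eventually_mono) (simp only: *)
  ultimately show ?thesis using True by (simp add: tendsto_cong)
next
  case False
  have "cross3 a (circle_point a t l) = sin l *\<^sub>R cross3 a t"
    by (simp add: circle_point_def cross_add_right cross_mult_right)
  then show ?thesis using False tendsto_cross3[OF perturb_tendsto[of a w q] perturb_tendsto[of "circle_point a t l" w' q']]
    by simp
qed

definition circle_arc :: "real^3 \<Rightarrow> real^3 \<Rightarrow> real \<Rightarrow> (real^3) set" where
  "circle_arc a t l = circle_point a t ` {0..l}"

lemma circle_point_antipode:
  "circle_point a t (\<theta> - pi) = - circle_point a t \<theta>" "circle_point a t (\<theta> + pi) = - circle_point a t \<theta>"
  by (simp_all add: circle_point_def cos_diff sin_diff)

lemma norm_circle_point: "frame a t \<Longrightarrow> norm (circle_point a t \<theta>) = 1"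
  using inner_circle_points[of a t \<theta> \<theta>] by (simp add: norm_eq_1)

text \<open>If one of the sines is not positive, the point leaves a piece of length at least
  \<open>pi\<close> on that side, and a step of \<open>pi\<close> stays on the arc.\<close>

lemma antipode_in_arc:
  assumes "0 < \<theta>" "\<theta> < l" "l < 2 * pi" "\<not> (0 < sin \<theta> \<and> 0 < sin (l - \<theta>))"
  shows "- circle_point a t \<theta> \<in> circle_arc a t l"
proof -
  have "\<theta> \<ge> pi \<or> l - \<theta> \<ge> pi" using assms sin_gt_zero[of \<theta>] sin_gt_zero[of "l - \<theta>"] by linarith
  then have "\<theta> - pi \<in> {0..l} \<or> \<theta> + pi \<in> {0..l}" using assms pi_gt_zero by auto
  then show ?thesis unfolding circle_arc_def using circle_point_antipode by (metis image_eqI)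
qed

lemma vec_eq_minus_iff: "x = - x \<longleftrightarrow> x = 0" for x :: "real^3"
  by (simp add: vec_eq_iff)

section \<open>From drawings to sign configurations\<close>

text \<open>\<open>st\<close> and \<open>fi\<close> direct each edge as its arc is parametrised.
  Crossings of disjoint edges are recorded as a single common point that is an end of
  neither.\<close>

locale great_circle_drawing =
  fixes V :: "'v set" and E :: "'v set set" and p :: "'v \<Rightarrow> real^3"
    and st fi :: "'v set \<Rightarrow> 'v" and tg :: "'v set \<Rightarrow> real^3" and len :: "'v set \<Rightarrow> real"
  assumes finite_V: "finite V" and inj: "inj_on p V"
    and edge: "e \<in> E \<Longrightarrow> {st e, fi e} = e" "e \<in> E \<Longrightarrow> st e \<noteq> fi e"
      "e \<in> E \<Longrightarrow> st e \<in> V" "e \<in> E \<Longrightarrow> fi e \<in> V"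
    and frame: "e \<in> E \<Longrightarrow> frame (p (st e)) (tg e)"
    and len: "e \<in> E \<Longrightarrow> 0 < len e" "e \<in> E \<Longrightarrow> len e < 2 * pi"
    and fi: "e \<in> E \<Longrightarrow> p (fi e) = circle_point (p (st e)) (tg e) (len e)"
    and meet: "\<lbrakk>e \<in> E; f \<in> E; e \<noteq> f\<rbrakk> \<Longrightarrow>
      \<exists>x. circle_arc (p (st e)) (tg e) (len e) \<inter> circle_arc (p (st f)) (tg f) (len f) = {x} \<and>
        (e \<inter> f = {} \<longrightarrow> x \<notin> p ` e \<and> x \<notin> p ` f)"
begin

abbreviation cp :: "'v set \<Rightarrow> real \<Rightarrow> real^3" where "cp e \<equiv> circle_point (p (st e)) (tg e)"
abbreviation edge_arc :: "'v set \<Rightarrow> (real^3) set" where "edge_arc e \<equiv> circle_arc (p (st e)) (tg e) (len e)"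

lemma ends_in: "e \<in> E \<Longrightarrow> st e \<in> e" "e \<in> E \<Longrightarrow> fi e \<in> e"
  using edge(1) by blast+

lemma edge_cases: "\<lbrakk>e \<in> E; v \<in> e\<rbrakk> \<Longrightarrow> v = st e \<or> v = fi e"
  using edge(1) by blast

lemma cp_in: "0 \<le> \<theta> \<Longrightarrow> \<theta> \<le> len e \<Longrightarrow> cp e \<theta> \<in> edge_arc e"
  by (auto simp: circle_arc_def)

lemma endpoint_in_arc:
  assumes "e \<in> E" "v \<in> e"
  shows "p v \<in> edge_arc e" "len e > pi \<Longrightarrow> - p v \<in> edge_arc e" "norm (p v) = 1"
proof -
  have "v = st e \<or> v = fi e" by (rule edge_cases[OF assms])
  then obtain \<theta> where \<theta>: "p v = cp e \<theta>" "\<theta> = 0 \<or> \<theta> = len e"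
    using fi[OF assms(1)] circle_point_0 by metis
  show "p v \<in> edge_arc e" using \<theta> cp_in[of \<theta> e] len[OF assms(1)] by auto
  show "norm (p v) = 1" using \<theta> norm_circle_point[OF frame[OF assms(1)]] by simp
  assume "len e > pi"
  then show "- p v \<in> edge_arc e"
    using \<theta> cp_in[of pi e] cp_in[of "len e - pi" e] circle_point_antipode pi_gt_zero by auto
qed

lemma long_edges_not_adjacent:
  assumes "e \<in> E" "f \<in> E" "v \<in> e" "v \<in> f" "len e > pi" "len f > pi"
  shows "e = f"
proof (rule ccontr)
  assume "e \<noteq> f"
  then obtain x where x: "edge_arc e \<inter> edge_arc f = {x}" using meet[OF assms(1,2)] by metis
  have "p v \<in> edge_arc e \<inter> edge_arc f" "- p v \<in> edge_arc e \<inter> edge_arc f"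
    using endpoint_in_arc(1,2)[OF assms(1,3)] endpoint_in_arc(1,2)[OF assms(2,4)] assms(5,6) by auto
  then have "p v = - p v" unfolding x by simp
  then show False using endpoint_in_arc(3)[OF assms(1,3)] unfolding vec_eq_minus_iff by simp
qed

text \<open>The other end of such an edge sits at \<open>- p v\<close>, and \<open>p\<close> is
  injective.\<close>

lemma pi_edge_unique:
  assumes "e \<in> E" "f \<in> E" "v \<in> e" "v \<in> f" "len e = pi" "len f = pi"
  shows "e = f"
proof -
  have *: "\<exists>z\<in>V. e = {v, z} \<and> p z = - p v" if "e \<in> E" "v \<in> e" "len e = pi" for e
  proof -
    have "p (fi e) = - p (st e)" using fi[OF that(1)] that by simp
    then show ?thesis
      using edge(1,3,4)[OF that(1)] edge_cases[OF that(1,2)] by (metis insert_commute minus_minus)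
  qed
  obtain a b where "a \<in> V" "b \<in> V" "e = {v, a}" "f = {v, b}" "p a = p b"
    using *[of e] *[of f] assms by metis
  then show ?thesis using inj by (metis inj_onD)
qed

text \<open>Each of the last two claims comes from the uniqueness of the common point: arcs on one
  great circle would share a piece near it, and without the sine condition both arcs would contain
  its antipode.\<close>

lemma disjoint_edges_cross:
  assumes "e \<in> E" "f \<in> E" "e \<inter> f = {}"
  obtains \<theta> \<phi> where "0 < \<theta>" "\<theta> < len e" "0 < \<phi>" "\<phi> < len f" "cp e \<theta> = cp f \<phi>"
    "cross3 (p (st f)) (tg f) \<bullet> circle_point (tg e) (- p (st e)) \<theta> \<noteq> 0"
    "0 < sin \<theta> \<and> 0 < sin (len e - \<theta>) \<or> 0 < sin \<phi> \<and> 0 < sin (len f - \<phi>)"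
proof -
  note fe = frame[OF assms(1)] and ff = frame[OF assms(2)]
  have "e \<noteq> f" using assms ends_in by blast
  then obtain x where x: "edge_arc e \<inter> edge_arc f = {x}" "x \<notin> p ` e" "x \<notin> p ` f"
    using meet[OF assms(1,2)] assms(3) by metis
  have "x \<in> edge_arc e" "x \<in> edge_arc f" using x(1) by blast+
  then obtain \<theta> \<phi> where \<theta>: "0 \<le> \<theta>" "\<theta> \<le> len e" "x = cp e \<theta>" and \<phi>: "0 \<le> \<phi>" "\<phi> \<le> len f" "x = cp f \<phi>"
    unfolding circle_arc_def by auto
  have "p (st e) \<noteq> x" "p (fi e) \<noteq> x" "p (st f) \<noteq> x" "p (fi f) \<noteq> x"
    using x(2,3) ends_in[OF assms(1)] ends_in[OF assms(2)] by blast+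
  then have "\<theta> \<noteq> 0" "\<theta> \<noteq> len e" "\<phi> \<noteq> 0" "\<phi> \<noteq> len f"
    using \<theta>(3) \<phi>(3) fi[OF assms(1)] fi[OF assms(2)] by auto
  then have r: "0 < \<theta>" "\<theta> < len e" "0 < \<phi>" "\<phi> < len f" using \<theta> \<phi> by auto
  have eq: "cp e \<theta> = cp f \<phi>" using \<theta> \<phi> by simp
  define T T' where "T = circle_point (tg e) (- p (st e)) \<theta>" and "T' = circle_point (tg f) (- p (st f)) \<phi>"
  have fr: "frame x T" "frame x T'"
    using frame_shift(1)[OF fe, of \<theta>] frame_shift(1)[OF ff, of \<phi>] \<theta>(3) \<phi>(3) by (auto simp: T_def T'_def)
  have shift: "cp e \<psi> = circle_point x T (\<psi> - \<theta>)" "cp f \<psi> = circle_point x T' (\<psi> - \<phi>)" for \<psi>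
    unfolding T_def T'_def using circle_point_shift \<theta>(3) \<phi>(3) by metis+
  have only: "z = x" if "z \<in> edge_arc e" "z \<in> edge_arc f" for z using that x(1) by blast
  have K: "cross3 (p (st f)) (tg f) \<bullet> T \<noteq> 0"
  proof
    assume "cross3 (p (st f)) (tg f) \<bullet> T = 0"
    then have "cross3 x T' \<bullet> T = 0" using frame_shift(2)[OF ff, of \<phi>] \<phi>(3) by (simp add: T'_def)
    then have "T = T' \<or> T = - T'" using coplanar_tangents[OF fr] by blast
    moreover
    \<comment> \<open>Small enough for a step forwards on \<open>e\<close> and a step in either
      direction on \<open>f\<close>, as the tangents may be opposite.\<close>
    define \<eta> where "\<eta> = min (len e - \<theta>) (min (len f - \<phi>) \<phi>) / 2"
    have \<eta>: "0 < \<eta>" "\<theta> + \<eta> \<le> len e" "\<phi> + \<eta> \<le> len f" "\<phi> - \<eta> \<ge> 0" "\<eta> < pi"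
      using r len(2)[OF assms(2)] unfolding \<eta>_def by (auto simp: min_def field_simps)
    have "cp f (\<phi> + \<eta>) = circle_point x T' \<eta>" "cp f (\<phi> - \<eta>) = circle_point x (- T') \<eta>" "cp e (\<theta> + \<eta>) = circle_point x T \<eta>"
      using shift by (simp_all add: circle_point_def)
    ultimately have "circle_point x T \<eta> \<in> edge_arc e" "circle_point x T \<eta> \<in> edge_arc f"
      using cp_in[of "\<theta> + \<eta>" e] cp_in[of "\<phi> + \<eta>" f] cp_in[of "\<phi> - \<eta>" f] r \<eta> by auto
    then have "circle_point x T \<eta> = x" using only by blast
    then have "cos \<eta> = 1" using inner_circle_points[OF fr(1), of \<eta> 0] frame_inner[OF fr(1)] by simp
    then show False using \<eta> cos_monotone_0_pi[of 0 \<eta>] by simp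
  qed
  have "0 < sin \<theta> \<and> 0 < sin (len e - \<theta>) \<or> 0 < sin \<phi> \<and> 0 < sin (len f - \<phi>)"
  proof (rule ccontr)
    assume "\<not> ?thesis"
    then have "- cp e \<theta> \<in> edge_arc e" "- cp f \<phi> \<in> edge_arc f"
      using antipode_in_arc[OF r(1,2) len(2)[OF assms(1)]] antipode_in_arc[OF r(3,4) len(2)[OF assms(2)]]
      by blast+
    then have "- x \<in> edge_arc e" "- x \<in> edge_arc f" using \<theta>(3) \<phi>(3) by metis+
    then have "x = - x" using only by metis
    then show False using fr(1) unfolding vec_eq_minus_iff by (simp add: frame_def)
  qed
  then show ?thesis using that r eq K unfolding T_def by blast
qed

text \<open>By \<open>pi_edge_unique\<close> the chosen edge is the only one possible, and a shoved
  far end is never the near end of another edge of length \<open>pi\<close>.\<close>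

definition shove :: "'v \<Rightarrow> real^3" where
  "shove v = (if \<exists>e\<in>E. len e = pi \<and> fi e = v then tg (SOME e. e \<in> E \<and> len e = pi \<and> fi e = v) else 0)"

lemma shove_pi_edge:
  assumes "e \<in> E" "len e = pi"
  shows "shove (st e) = 0 \<and> shove (fi e) = tg e"
proof
  have m: "st e \<in> e" "fi e \<in> e" "st e \<noteq> fi e" using ends_in edge(2) assms by auto
  have "\<not> (\<exists>f\<in>E. len f = pi \<and> fi f = st e)"
  proof
    assume "\<exists>f\<in>E. len f = pi \<and> fi f = st e"
    then obtain f where f: "f \<in> E" "len f = pi" "fi f = st e" by blast
    then have "e = f" using pi_edge_unique[OF assms(1) f(1) m(1)] ends_in[OF f(1)] f assms by auto
    then show False using f m by simp
  qed
  then show "shove (st e) = 0" by (auto simp: shove_def)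
  have "f = e" if "f \<in> E" "len f = pi" "fi f = fi e" for f
    using pi_edge_unique[OF assms(1) that(1) m(2) _ assms(2) that(2)] ends_in(2)[OF that(1)] that(3) by metis
  then have "(SOME f. f \<in> E \<and> len f = pi \<and> fi f = fi e) = e"
    using assms by (intro some_equality) auto
  then show "shove (fi e) = tg e" unfolding shove_def using assms by auto
qed

text \<open>The factor of the limiting normal in \<open>perturbed_normal\<close>; its sign separates
  short from long edges.\<close>

definition gain :: "'v set \<Rightarrow> real" where "gain e = (if len e = pi then 1 else sin (len e))"

lemma gain_sign:
  assumes "e \<in> E" shows "len e \<le> pi \<Longrightarrow> gain e > 0" "len e > pi \<Longrightarrow> gain e < 0"
  using len[OF assms] sin_gt_zero[of "len e"] sin_lt_zero[of "len e"] by (auto simp: gain_def)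

definition position :: "('v \<Rightarrow> nat) \<Rightarrow> real \<Rightarrow> 'v \<Rightarrow> real^3" where
  "position i s v = perturb (p v) (shove v) (moment (real (i v))) s"

text \<open>A pair of a short and a long edge is read with the long edge first.\<close>

definition crossing :: "('v \<Rightarrow> real^3) \<Rightarrow> 'v set \<Rightarrow> 'v set \<Rightarrow> bool" where
  "crossing P e f \<longleftrightarrow> (\<exists>\<alpha> \<beta> \<gamma> \<delta>.
    \<alpha> *\<^sub>R P (st e) + \<beta> *\<^sub>R P (fi e) = \<gamma> *\<^sub>R P (st f) + \<delta> *\<^sub>R P (fi f) \<and>
    (len e \<le> pi \<and> len f \<le> pi \<longrightarrow> \<alpha> > 0 \<and> \<beta> > 0 \<and> \<gamma> > 0 \<and> \<delta> > 0) \<and>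
    (len e > pi \<and> len f \<le> pi \<longrightarrow> (\<alpha> < 0 \<or> \<beta> < 0) \<and> \<gamma> > 0 \<and> \<delta> > 0) \<and>
    (len e > pi \<and> len f > pi \<longrightarrow>
      \<alpha> > 0 \<and> \<beta> > 0 \<and> (\<gamma> > 0 \<or> \<delta> > 0) \<or> \<gamma> > 0 \<and> \<delta> > 0 \<and> (\<alpha> > 0 \<or> \<beta> > 0)))"

lemma eventually_crossing:
  assumes "e \<in> E" "f \<in> E" "e \<inter> f = {}"
  shows "eventually (\<lambda>s. crossing (position i s) e f) (at_right 0)"
proof -
  obtain \<theta> \<phi> where r: "0 < \<theta>" "\<theta> < len e" "0 < \<phi>" "\<phi> < len f" and eq: "cp e \<theta> = cp f \<phi>"
    and K: "cross3 (p (st f)) (tg f) \<bullet> circle_point (tg e) (- p (st e)) \<theta> \<noteq> 0"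
    and LL: "0 < sin \<theta> \<and> 0 < sin (len e - \<theta>) \<or> 0 < sin \<phi> \<and> 0 < sin (len f - \<phi>)"
    using disjoint_edges_cross[OF assms] .
  have lim: "((\<lambda>s. position i s v) \<longlongrightarrow> p v) (at_right 0)" for v
    unfolding position_def by (rule perturb_tendsto)
  have nrm: "((\<lambda>s. (1 / (if len e = pi then s else 1)) *\<^sub>R cross3 (position i s (st e)) (position i s (fi e))) \<longlongrightarrow>
    gain e *\<^sub>R cross3 (p (st e)) (tg e)) (at_right 0)" if "e \<in> E" for e
    unfolding position_def gain_def fi[OF that] by (rule perturbed_normal) (use shove_pi_edge[OF that] in auto)
  have gn: "gain e \<noteq> 0" "gain f \<noteq> 0" using gain_sign[OF assms(1)] gain_sign[OF assms(2)] by fastforce+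
  have e1: "0 < sin \<theta> \<or> 0 < sin (len e - \<theta>)" "len e \<le> pi \<Longrightarrow> 0 < sin \<theta> \<and> 0 < sin (len e - \<theta>)"
    using r len[OF assms(1)] sin_gt_zero[of \<theta>] sin_gt_zero[of "len e - \<theta>"] by linarith+
  have f1: "0 < sin \<phi> \<or> 0 < sin (len f - \<phi>)" "len f \<le> pi \<Longrightarrow> 0 < sin \<phi> \<and> 0 < sin (len f - \<phi>)"
    using r len[OF assms(2)] sin_gt_zero[of \<phi>] sin_gt_zero[of "len f - \<phi>"] by linarith+
  have "eventually (\<lambda>s. \<exists>\<alpha> \<beta> \<gamma> \<delta>.
      \<alpha> *\<^sub>R position i s (st e) + \<beta> *\<^sub>R position i s (fi e) = \<gamma> *\<^sub>R position i s (st f) + \<delta> *\<^sub>R position i s (fi f) \<and>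
      (0 < sin (len e - \<theta>) \<longrightarrow> 0 < gain f * \<alpha>) \<and> (0 < sin \<theta> \<longrightarrow> 0 < gain f * \<beta>) \<and>
      (0 < sin (len f - \<phi>) \<longrightarrow> 0 < gain e * \<gamma>) \<and> (0 < sin \<phi> \<longrightarrow> 0 < gain e * \<delta>)) (at_right 0)"
    by (rule crossing_coefficient_signs[OF frame[OF assms(1)] frame[OF assms(2)] eq K lim _ lim _ nrm[OF assms(1)] nrm[OF assms(2)] _ _ gn])
      (auto simp: fi[OF assms(1), symmetric] fi[OF assms(2), symmetric] intro: lim)
  then show ?thesis
  proof (rule eventually_mono)
    fix s
    assume "\<exists>\<alpha> \<beta> \<gamma> \<delta>.
      \<alpha> *\<^sub>R position i s (st e) + \<beta> *\<^sub>R position i s (fi e) = \<gamma> *\<^sub>R position i s (st f) + \<delta> *\<^sub>R position i s (fi f) \<and>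
      (0 < sin (len e - \<theta>) \<longrightarrow> 0 < gain f * \<alpha>) \<and> (0 < sin \<theta> \<longrightarrow> 0 < gain f * \<beta>) \<and>
      (0 < sin (len f - \<phi>) \<longrightarrow> 0 < gain e * \<gamma>) \<and> (0 < sin \<phi> \<longrightarrow> 0 < gain e * \<delta>)"
    then obtain \<alpha> \<beta> \<gamma> \<delta> where
      D: "\<alpha> *\<^sub>R position i s (st e) + \<beta> *\<^sub>R position i s (fi e) = \<gamma> *\<^sub>R position i s (st f) + \<delta> *\<^sub>R position i s (fi f)"
      and c: "0 < sin (len e - \<theta>) \<Longrightarrow> 0 < gain f * \<alpha>" "0 < sin \<theta> \<Longrightarrow> 0 < gain f * \<beta>"
        "0 < sin (len f - \<phi>) \<Longrightarrow> 0 < gain e * \<gamma>" "0 < sin \<phi> \<Longrightarrow> 0 < gain e * \<delta>" by blast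
    \<comment> \<open>For a long \<open>e\<close> the negative gain makes \<gamma> and \<delta> come
      out with the wrong sign, and the relation is used at the antipodal point.\<close>
    have D': "(- \<alpha>) *\<^sub>R position i s (st e) + (- \<beta>) *\<^sub>R position i s (fi e) =
      (- \<gamma>) *\<^sub>R position i s (st f) + (- \<delta>) *\<^sub>R position i s (fi f)"
      using arg_cong[OF D, of uminus] by simp
    have pos: "0 < g * x \<Longrightarrow> g > 0 \<Longrightarrow> x > 0" "0 < g * x \<Longrightarrow> g < 0 \<Longrightarrow> - x > 0" for g x :: real
      by (auto simp: zero_less_mult_iff)
    show "crossing (position i s) e f"
    proof (cases "len e \<le> pi")
      case True
      note ge = gain_sign(1)[OF assms(1) True]
      show ?thesis
      proof (cases "len f \<le> pi")
        case T2: True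
        note gf = gain_sign(1)[OF assms(2) T2]
        have "\<alpha> > 0" "\<beta> > 0" "\<gamma> > 0" "\<delta> > 0" using e1(2)[OF True] f1(2)[OF T2] c pos(1) ge gf by metis+
        then show ?thesis unfolding crossing_def using D True T2 by (intro exI[of _ \<alpha>] exI[of _ \<beta>] exI[of _ \<gamma>] exI[of _ \<delta>]) auto
      next
        case False
        then show ?thesis unfolding crossing_def using D True by (intro exI[of _ \<alpha>] exI[of _ \<beta>] exI[of _ \<gamma>] exI[of _ \<delta>]) auto
      qed
    next
      case False
      note ge = gain_sign(2)[OF assms(1)]
      show ?thesis
      proof (cases "len f \<le> pi")
        case True
        note gf = gain_sign(1)[OF assms(2) True]
        have "- \<gamma> > 0" "- \<delta> > 0" using f1(2)[OF True] c pos(2) ge False by (metis not_le)+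
        moreover have "- \<alpha> < 0 \<or> - \<beta> < 0" using e1(1) c pos(1) gf by (metis neg_less_0_iff_less)
        ultimately show ?thesis unfolding crossing_def using D' False True
          by (intro exI[of _ "- \<alpha>"] exI[of _ "- \<beta>"] exI[of _ "- \<gamma>"] exI[of _ "- \<delta>"]) auto
      next
        case F2: False
        note gf = gain_sign(2)[OF assms(2)]
        have "0 < sin (len e - \<theta>) \<Longrightarrow> - \<alpha> > 0" "0 < sin \<theta> \<Longrightarrow> - \<beta> > 0"
          "0 < sin (len f - \<phi>) \<Longrightarrow> - \<gamma> > 0" "0 < sin \<phi> \<Longrightarrow> - \<delta> > 0"
          using c pos(2) ge gf False F2 by (metis not_le)+
        then have "- \<alpha> > 0 \<and> - \<beta> > 0 \<and> (- \<gamma> > 0 \<or> - \<delta> > 0) \<or> - \<gamma> > 0 \<and> - \<delta> > 0 \<and> (- \<alpha> > 0 \<or> - \<beta> > 0)"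
          using LL e1(1) f1(1) by blast
        then show ?thesis unfolding crossing_def using D' False F2
          by (intro exI[of _ "- \<alpha>"] exI[of _ "- \<beta>"] exI[of _ "- \<gamma>"] exI[of _ "- \<delta>"]) auto
      qed
    qed
  qed
qed

lemma finite_E: "finite E"
proof (rule finite_subset)
  show "E \<subseteq> Pow V" using edge_cases edge(3,4) by blast
qed (simp add: finite_V)

lemma good_perturbation:
  obtains P where "\<And>a b c. \<lbrakk>a \<in> V; b \<in> V; c \<in> V; a \<noteq> b; b \<noteq> c; a \<noteq> c\<rbrakk> \<Longrightarrow> triple (P a) (P b) (P c) \<noteq> 0"
    "\<And>e f. \<lbrakk>e \<in> E; f \<in> E; e \<inter> f = {}\<rbrakk> \<Longrightarrow> crossing P e f"
proof -
  obtain i :: "'v \<Rightarrow> nat" where i: "inj_on i V" using finite_imp_inj_to_nat_seg[OF finite_V] by blast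
  have 1: "eventually (\<lambda>s. a \<noteq> b \<and> b \<noteq> c \<and> a \<noteq> c \<longrightarrow> triple (position i s a) (position i s b) (position i s c) \<noteq> 0) (at_right 0)"
    if "a \<in> V" "b \<in> V" "c \<in> V" for a b c
  proof (cases "a \<noteq> b \<and> b \<noteq> c \<and> a \<noteq> c")
    case True
    then have "i a \<noteq> i b" "i b \<noteq> i c" "i a \<noteq> i c" using i that by (auto dest: inj_onD)
    then have "triple (moment (real (i a))) (moment (real (i b))) (moment (real (i c))) \<noteq> 0"
      by (simp add: triple_moment)
    then show ?thesis unfolding position_def using perturb_general_position by (simp add: eventually_mono)
  qed auto
  have 2: "eventually (\<lambda>s. e \<inter> f = {} \<longrightarrow> crossing (position i s) e f) (at_right 0)" if "e \<in> E" "f \<in> E" for e f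
    using eventually_crossing[OF that] by (cases "e \<inter> f = {}") auto
  have "eventually (\<lambda>s. (\<forall>a\<in>V. \<forall>b\<in>V. \<forall>c\<in>V. a \<noteq> b \<and> b \<noteq> c \<and> a \<noteq> c \<longrightarrow>
      triple (position i s a) (position i s b) (position i s c) \<noteq> 0) \<and>
    (\<forall>e\<in>E. \<forall>f\<in>E. e \<inter> f = {} \<longrightarrow> crossing (position i s) e f)) (at_right (0::real))"
    using 1 2 by (intro eventually_conj eventually_ball_finite finite_V finite_E ballI)
  from eventually_happens[OF this] obtain s where s:
    "\<forall>a\<in>V. \<forall>b\<in>V. \<forall>c\<in>V. a \<noteq> b \<and> b \<noteq> c \<and> a \<noteq> c \<longrightarrow> triple (position i s a) (position i s b) (position i s c) \<noteq> 0"
    "\<forall>e\<in>E. \<forall>f\<in>E. e \<inter> f = {} \<longrightarrow> crossing (position i s) e f" by (auto simp: trivial_limit_at_right_real)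
  show ?thesis
  proof (rule that[of "position i s"])
    show "triple (position i s a) (position i s b) (position i s c) \<noteq> 0"
      if "a \<in> V" "b \<in> V" "c \<in> V" "a \<noteq> b" "b \<noteq> c" "a \<noteq> c" for a b c using s(1) that by metis
    show "crossing (position i s) e f" if "e \<in> E" "f \<in> E" "e \<inter> f = {}" for e f using s(2) that by metis
  qed
qed

lemma card_edges_le: "card E \<le> card V"
proof -
  obtain P where P: "\<And>a b c. \<lbrakk>a \<in> V; b \<in> V; c \<in> V; a \<noteq> b; b \<noteq> c; a \<noteq> c\<rbrakk> \<Longrightarrow> triple (P a) (P b) (P c) \<noteq> 0"
    and X: "\<And>e f. \<lbrakk>e \<in> E; f \<in> E; e \<inter> f = {}\<rbrakk> \<Longrightarrow> crossing P e f" using good_perturbation by blast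
  define \<Delta> where "\<Delta> a b c = triple (P a) (P b) (P c)" for a b c
  define S L where "S a b \<longleftrightarrow> {a, b} \<in> E \<and> len {a, b} \<le> pi" and "L a b \<longleftrightarrow> {a, b} \<in> E \<and> len {a, b} > pi" for a b
  have dep: "\<alpha> * \<Delta> x y a + \<beta> * \<Delta> x y b = \<gamma> * \<Delta> x y c + \<delta> * \<Delta> x y d"
    if "\<alpha> *\<^sub>R P a + \<beta> *\<^sub>R P b = \<gamma> *\<^sub>R P c + \<delta> *\<^sub>R P d" for \<alpha> \<beta> \<gamma> \<delta> a b c d x y
    using arg_cong[OF that, of "triple (P x) (P y)"] by (simp add: \<Delta>_def triple_add triple_scaleR)
  have inV: "a \<in> V" "a \<noteq> b" if "{a, b} \<in> E" for a b
    using edge[OF that] by (metis insertI1 edge_cases that, metis doubleton_eq_iff)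
  \<comment> \<open>The sign conditions are symmetric in \<alpha>, \<beta> and in \<gamma>,
    \<delta>, so the directions given by \<open>st\<close> and \<open>fi\<close> can be
    forgotten.\<close>
  have cr: "\<exists>\<alpha> \<beta> \<gamma> \<delta>. (\<forall>x y. \<alpha> * \<Delta> x y a + \<beta> * \<Delta> x y b = \<gamma> * \<Delta> x y c + \<delta> * \<Delta> x y d) \<and>
    (S a b \<and> S c d \<longrightarrow> \<alpha> > 0 \<and> \<beta> > 0 \<and> \<gamma> > 0 \<and> \<delta> > 0) \<and>
    (L a b \<and> S c d \<longrightarrow> (\<alpha> < 0 \<or> \<beta> < 0) \<and> \<gamma> > 0 \<and> \<delta> > 0) \<and>
    (L a b \<and> L c d \<longrightarrow>
      \<alpha> > 0 \<and> \<beta> > 0 \<and> (\<gamma> > 0 \<or> \<delta> > 0) \<or> \<gamma> > 0 \<and> \<delta> > 0 \<and> (\<alpha> > 0 \<or> \<beta> > 0))"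
    if ab: "{a, b} \<in> E" "{c, d} \<in> E" "{a, b} \<inter> {c, d} = {}" for a b c d
  proof -
    obtain \<alpha> \<beta> \<gamma> \<delta> where D: "\<alpha> *\<^sub>R P (st {a, b}) + \<beta> *\<^sub>R P (fi {a, b}) = \<gamma> *\<^sub>R P (st {c, d}) + \<delta> *\<^sub>R P (fi {c, d})"
      and c: "S a b \<and> S c d \<longrightarrow> \<alpha> > 0 \<and> \<beta> > 0 \<and> \<gamma> > 0 \<and> \<delta> > 0"
      "L a b \<and> S c d \<longrightarrow> (\<alpha> < 0 \<or> \<beta> < 0) \<and> \<gamma> > 0 \<and> \<delta> > 0"
      "L a b \<and> L c d \<longrightarrow>
      \<alpha> > 0 \<and> \<beta> > 0 \<and> (\<gamma> > 0 \<or> \<delta> > 0) \<or> \<gamma> > 0 \<and> \<delta> > 0 \<and> (\<alpha> > 0 \<or> \<beta> > 0)"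
      using X[OF ab] unfolding crossing_def S_def L_def by blast
    have "a = st {a, b} \<and> b = fi {a, b} \<or> b = st {a, b} \<and> a = fi {a, b}"
      "c = st {c, d} \<and> d = fi {c, d} \<or> d = st {c, d} \<and> c = fi {c, d}"
      using edge(1)[OF ab(1)] edge(1)[OF ab(2)] by (metis doubleton_eq_iff)+
    then consider "st {a, b} = a" "fi {a, b} = b" "st {c, d} = c" "fi {c, d} = d"
      | "st {a, b} = a" "fi {a, b} = b" "st {c, d} = d" "fi {c, d} = c"
      | "st {a, b} = b" "fi {a, b} = a" "st {c, d} = c" "fi {c, d} = d"
      | "st {a, b} = b" "fi {a, b} = a" "st {c, d} = d" "fi {c, d} = c" by metis
    then show ?thesis
    proof cases
      case 1
      have "\<forall>x y. \<alpha> * \<Delta> x y a + \<beta> * \<Delta> x y b = \<gamma> * \<Delta> x y c + \<delta> * \<Delta> x y d"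
        using D unfolding 1 by (intro allI dep) (simp only: add.commute)
      then show ?thesis
        by (intro exI[of _ \<alpha>] exI[of _ \<beta>] exI[of _ \<gamma>] exI[of _ \<delta>] conjI) (assumption | use c in blast)+
    next
      case 2
      have "\<forall>x y. \<alpha> * \<Delta> x y a + \<beta> * \<Delta> x y b = \<delta> * \<Delta> x y c + \<gamma> * \<Delta> x y d"
        using D unfolding 2 by (intro allI dep) (simp only: add.commute)
      then show ?thesis
        by (intro exI[of _ \<alpha>] exI[of _ \<beta>] exI[of _ \<delta>] exI[of _ \<gamma>] conjI) (assumption | use c in blast)+
    next
      case 3
      have "\<forall>x y. \<beta> * \<Delta> x y a + \<alpha> * \<Delta> x y b = \<gamma> * \<Delta> x y c + \<delta> * \<Delta> x y d"
        using D unfolding 3 by (intro allI dep) (simp only: add.commute)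
      then show ?thesis
        by (intro exI[of _ \<beta>] exI[of _ \<alpha>] exI[of _ \<gamma>] exI[of _ \<delta>] conjI) (assumption | use c in blast)+
    next
      case 4
      have "\<forall>x y. \<beta> * \<Delta> x y a + \<alpha> * \<Delta> x y b = \<delta> * \<Delta> x y c + \<gamma> * \<Delta> x y d"
        using D unfolding 4 by (intro allI dep) (simp only: add.commute)
      then show ?thesis
        by (intro exI[of _ \<beta>] exI[of _ \<alpha>] exI[of _ \<delta>] exI[of _ \<gamma>] conjI) (assumption | use c in blast)+
    qed
  qed
  have conf: "thrackle_configuration V \<Delta> S L"
  proof (unfold_locales, goal_cases)
    case 1 show ?case by (rule finite_V)
  next
    case 2 show ?case unfolding \<Delta>_def by (rule triple_rotate)
  next
    case 3 show ?case unfolding \<Delta>_def by (rule triple_swap)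
  next
    case 4 then show ?case unfolding \<Delta>_def by (intro P)
  next
    case 5 then show ?case by (simp add: S_def insert_commute)
  next
    case 6 then show ?case by (simp add: L_def insert_commute)
  next
    case 7 then show ?case using inV by (auto simp: S_def)
  next
    case 8 then show ?case using inV by (auto simp: L_def)
  next
    case (9 a) then show ?case using inV(2)[of a a] by (auto simp: S_def)
  next
    case (10 a) then show ?case using inV(2)[of a a] by (auto simp: L_def)
  next
    case 11 then show ?case by (simp add: S_def L_def)
  next
    case (12 a b c)
    then have "{a, b} = {a, c}" unfolding L_def by (intro long_edges_not_adjacent[of _ _ a]) auto
    then show ?case by (auto simp: doubleton_eq_iff)
  next
    case (13 a b c d)
    then show ?case using cr[of a b c d] unfolding S_def by blast
  next
    case (14 a b c d)
    then show ?case using cr[of a b c d] unfolding S_def L_def by blast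
  next
    case (15 a b c d)
    then show ?case using cr[of a b c d] unfolding L_def by blast
  qed
  interpret c: thrackle_configuration V \<Delta> S L by (rule conf)
  have "c.edges = E"
  proof
    show "c.edges \<subseteq> E" by (auto simp: c.edges_def c.adj_def S_def L_def)
    show "E \<subseteq> c.edges"
    proof
      fix e assume "e \<in> E"
      then show "e \<in> c.edges" unfolding c.edges_def c.adj_def S_def L_def
        using edge(1)[of e] by (intro CollectI exI[of _ "st e"] exI[of _ "fi e"]) auto
    qed
  qed
  then show ?thesis using thrackle_configuration_edges_le_vertices[OF conf] by simp
qed

end

theorem theorem1p1:
  fixes V :: "'v set" and E :: "'v set set" and n m :: nat
  assumes "finite_graph V E" and "card V = n" and "card E = m"
    and "\<exists>p \<gamma>. spherical_thrackle_drawing V E p \<gamma>"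
  shows "n \<ge> m"
proof -
  obtain p \<gamma> where T: "spherical_thrackle_drawing V E p \<gamma>" using assms(4) by blast
  then have dr: "drawing (sphere 0 1) V E p \<gamma>" and gc: "\<And>e. e \<in> E \<Longrightarrow> great_circle_arc (\<gamma> e)"
    and td: "thrackle_drawing (sphere 0 1) V E p \<gamma>"
    by (auto simp: spherical_thrackle_drawing_def thrackle_drawing_def)
  have inj: "inj_on p V" using dr by (simp add: drawing_def)
  define Q where "Q e u v t l \<longleftrightarrow> e = {u, v} \<and> u \<noteq> v \<and> u \<in> V \<and> v \<in> V \<and> frame (p u) t \<and> 0 < l \<and> l < 2 * pi \<and>
      p v = circle_point (p u) t l \<and> path_image (\<gamma> e) = circle_arc (p u) t l \<and>
      {pathstart (\<gamma> e), pathfinish (\<gamma> e)} = p ` e" for e u v t l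
  have "\<exists>u v t l. Q e u v t l" if e: "e \<in> E" for e
  proof -
    obtain a b l where A: "norm a = 1" "norm b = 1" "a \<bullet> b = 0" "0 < l" "l < 2 * pi"
      "path_image (\<gamma> e) = (\<lambda>t. cos t *\<^sub>R a + sin t *\<^sub>R b) ` {0..l}"
      "pathstart (\<gamma> e) = a" "pathfinish (\<gamma> e) = cos l *\<^sub>R a + sin l *\<^sub>R b"
      using gc[OF e] unfolding great_circle_arc_def by blast
    obtain u v where uv: "u \<in> V" "v \<in> V" "u \<noteq> v" "e = {u, v}"
      using assms(1) e unfolding finite_graph_def by blast
    have im: "{pathstart (\<gamma> e), pathfinish (\<gamma> e)} = p ` e" using dr e by (simp add: drawing_def)
    have I: "path_image (\<gamma> e) = circle_arc a b l" "pathfinish (\<gamma> e) = circle_point a b l" "frame a b"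
      using A by (auto simp: circle_arc_def circle_point_def frame_def)
    have "a = p u \<and> circle_point a b l = p v \<or> a = p v \<and> circle_point a b l = p u"
      using im uv A(7) I(2) by (auto simp: doubleton_eq_iff)
    then show ?thesis
    proof
      assume "a = p u \<and> circle_point a b l = p v"
      then have au: "p u = a" "p v = circle_point a b l" by auto
      have "Q e u v b l" unfolding Q_def au
        using uv I A(4,5) im by (intro conjI) (assumption | rule refl)+
      then show ?thesis by blast
    next
      assume "a = p v \<and> circle_point a b l = p u"
      then have av: "p v = a" "p u = circle_point a b l" by auto
      have "v \<noteq> u" "e = {v, u}" using uv by auto
      then have "Q e v u b l" unfolding Q_def av
        using uv(1,2) I A(4,5) im by (intro conjI) (assumption | rule refl)+
      then show ?thesis by blast
    qed
  qed
  then obtain st fi tg len where "\<And>e. e \<in> E \<Longrightarrow> Q e (st e) (fi e) (tg e) (len e)" by metis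
  note * = this[unfolded Q_def]
  have "great_circle_drawing V E p st fi tg len"
  proof
    show "finite V" using assms(1) by (simp add: finite_graph_def)
    fix e f assume ef: "e \<in> E" "f \<in> E" "e \<noteq> f"
    then obtain x where x: "path_image (\<gamma> e) \<inter> path_image (\<gamma> f) = {x}"
      "x \<in> p ` (e \<inter> f) \<or> proper_crossing (sphere 0 1) (\<gamma> e) (\<gamma> f) x"
      using td unfolding thrackle_drawing_def by blast
    \<comment> \<open>Disjoint edges leave no vertex for the first alternative in
      \<open>x(2)\<close>, so the point is a proper crossing and interior to both arcs.\<close>
    have "x \<notin> p ` e \<and> x \<notin> p ` f" if "e \<inter> f = {}"
      using x(2) that *[OF ef(1)] *[OF ef(2)] unfolding proper_crossing_def by auto
    then show "\<exists>x. circle_arc (p (st e)) (tg e) (len e) \<inter> circle_arc (p (st f)) (tg f) (len f) = {x} \<and>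
        (e \<inter> f = {} \<longrightarrow> x \<notin> p ` e \<and> x \<notin> p ` f)"
      using x(1) *[OF ef(1)] *[OF ef(2)] by auto
  next
    show "{st e, fi e} = e" "st e \<noteq> fi e" "st e \<in> V" "fi e \<in> V" "frame (p (st e)) (tg e)" "0 < len e"
      "len e < 2 * pi" "p (fi e) = circle_point (p (st e)) (tg e) (len e)" if "e \<in> E" for e
      using *[OF that] by blast+
  qed (rule inj)
  then show ?thesis using great_circle_drawing.card_edges_le assms(2,3) by blast
qed

end
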